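(* Let $\Phi$ be a homogeneous Poisson point process of intensity $\lambda>0$ on $\mathbb{R}^2$, let $\Upsilon$ be the point process on the $x$-axis formed by the intersections of the $x$-axis with the one-dimensional facets of the Voronoi tessellation of $\Phi$, and for $Z\in\Upsilon$ let $\Theta(Z)=\widehat{X_1(Z),Z,X_2(Z)}\in(0,2\pi)$, where $X_1(Z)<X_2(Z)$ are the two ordered Delaunay neighbors associated with the facet containing $Z$. Then the Palm distribution with respect to $\Upsilon$ of $\Theta=\Theta(0)$ has a density equal to $$f_\Theta(t)=\frac14\sin\frac t2,\qquad 0<t<2\pi.$$
   Context: The Voronoi cell of $X\in\Phi$ is $\mathcal{V}_X=\{x\in\mathbb{R}^2:\ \|x-X\|\le \inf_{Y\in\Phi\setminus\{X\}}\|x-Y\|\}$. The one-dimensional facets are the segments (of positive length) $\mathcal{V}_X\cap\mathcal{V}_Y$, $X\ne Y\in\Phi$; $X,Y$ are the Delaunay neighbors associated with the facet. The $x$-axis represents a straight line with random orientation and random distance to the origin, independent of $\Phi$ (by isotropy and stationarity of $\Phi$ the line is taken to be the $x$-axis). Almost surely, each point of $\Upsilon$ belongs to exactly one one-dimensional facet. Points of $\mathbb{R}^2$ are ordered by the natural order on the $x$-coordinate. For $D<D'$ in this order and $Z\in\mathbb{R}^2$, $\widehat{D,Z,D'}$ denotes the oriented angle from $D$ to $D'$ as seen from the origin $Z$, measured in the anti-trigonometric (clockwise) direction, modulo $2\pi$. $\Upsilon$ is a stationary point process on $\mathbb{R}$ (identified with the $x$-axis) with linear intensity $\mu=\frac{4\sqrt\lambda}{\pi}$,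 and the $\Theta(Z)$ are marks of $\Upsilon$. The Palm distribution of $\Theta$ with respect to $\Upsilon$ is the probability measure $$\mathbb{P}^0_\Upsilon(\Theta(0)\in B)=\frac1\mu\,\mathbb{E}\Big[\sum_{Z\in\Upsilon}\mathbf{1}_{Z\in[0,1]}\mathbf{1}_{\Theta(Z)\in B}\Big],\qquad B\subset(0,2\pi)\ \text{Borel}.$$ *)

theory Defs
  imports "HOL-Probability.Probability"
begin

text \<open>
  The point process is a locally finite random set. Boundedness of the sets \<open>B\<close> makes
  \<open>card\<close> a genuine count.
\<close>
locale homogeneous_poisson_process = prob_space M
  for M :: "'w measure" and \<Phi> :: "'w \<Rightarrow> 'a::euclidean_space set" and intensity :: real +
  assumes locally_finite:
      "\<And>\<omega> B. \<omega> \<in> space M \<Longrightarrow> bounded B \<Longrightarrow> finite (\<Phi> \<omega> \<inter> B)"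
    and measurable_count:
      "\<And>B. B \<in> sets borel \<Longrightarrow> bounded B \<Longrightarrow>
        (\<lambda>\<omega>. card (\<Phi> \<omega> \<inter> B)) \<in> measurable M (count_space UNIV)"
    and poisson_count:
      "\<And>B k. B \<in> sets borel \<Longrightarrow> bounded B \<Longrightarrow>
        prob {\<omega> \<in> space M. card (\<Phi> \<omega> \<inter> B) = k} =
          (intensity * measure lborel B) ^ k / fact k * exp (- (intensity * measure lborel B))"
    and indep_counts:
      "\<And>(I :: nat set) B. finite I \<Longrightarrow> disjoint_family_on B I \<Longrightarrow>
        (\<And>i. i \<in> I \<Longrightarrow> B i \<in> sets borel \<and> bounded (B i)) \<Longrightarrow>
        indep_vars (\<lambda>_. count_space UNIV) (\<lambda>i \<omega>. card (\<Phi> \<omega> \<inter> B i)) I"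

type_synonym point = "real \<times> real"

text \<open>The infimum is taken in \<^typ>\<open>ereal\<close> so that it is infinite over the empty set.\<close>
definition voronoi_cell :: "point set \<Rightarrow> point \<Rightarrow> point set" where
  "voronoi_cell S X = {x. ereal (norm (x - X)) \<le> (INF Y\<in>S - {X}. ereal (norm (x - Y)))}"

text \<open>
  Intersections of two distinct cells are closed convex subsets of a line, so dimension 1 says
  that the intersection is a segment of positive length (for a Poisson process cells are almost
  surely bounded).
\<close>
definition voronoi_facet :: "point set \<Rightarrow> point \<Rightarrow> point \<Rightarrow> bool" where
  "voronoi_facet S X Y \<longleftrightarrow> X \<in> S \<and> Y \<in> S \<and> X \<noteq> Y \<and>
     aff_dim (voronoi_cell S X \<inter> voronoi_cell S Y) = 1"

text \<open>The point \<open>z\<close> of the real line stands for \<open>(z, 0)\<close> on the \<open>x\<close>-axis.\<close>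
definition facet_crossings :: "point set \<Rightarrow> real set" where
  "facet_crossings S =
     {z. \<exists>X Y. voronoi_facet S X Y \<and> (z, 0) \<in> voronoi_cell S X \<inter> voronoi_cell S Y}"

text \<open>
  Well-defined only if \<open>z\<close> lies on exactly one facet and the two neighbors have different
  first coordinates. For a Poisson process this holds almost surely at all crossings.
\<close>
definition delaunay_neighbors :: "point set \<Rightarrow> real \<Rightarrow> point \<times> point" where
  "delaunay_neighbors S z =
     (THE (X, Y). voronoi_facet S X Y \<and> (z, 0) \<in> voronoi_cell S X \<inter> voronoi_cell S Y \<and>
        fst X < fst Y)"

text \<open>
  Turning clockwise from \<open>D\<close> to \<open>D'\<close> is turning counterclockwise from \<open>D'\<close> to \<open>D\<close>,
  hence the order of the quotient; values are in \<open>[0, 2\<pi>)\<close>.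
\<close>
definition clockwise_angle :: "point \<Rightarrow> point \<Rightarrow> point \<Rightarrow> real" where
  "clockwise_angle D Z D' =
     Arg2pi (Complex (fst (D - Z)) (snd (D - Z)) / Complex (fst (D' - Z)) (snd (D' - Z)))"

definition crossing_angle :: "point set \<Rightarrow> real \<Rightarrow> real" where
  "crossing_angle S z =
     (case delaunay_neighbors S z of (X\<^sub>1, X\<^sub>2) \<Rightarrow> clockwise_angle X\<^sub>1 (z, 0) X\<^sub>2)"

text \<open>
  Palm distribution of the marks \<open>\<Theta>\<close> (with values in \<open>N\<close>) of a stationary point process
  \<open>\<Upsilon>\<close> on the line with linear intensity \<open>\<mu>\<close>. The integral over the counting measure is
  the sum over the points of \<open>\<Upsilon>\<close> in the unit interval.
\<close>
definition palm_mark_distribution ::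
  "'w measure \<Rightarrow> real \<Rightarrow> ('w \<Rightarrow> real set) \<Rightarrow> ('w \<Rightarrow> real \<Rightarrow> 'b) \<Rightarrow> 'b measure \<Rightarrow> 'b measure"
  where
  "palm_mark_distribution M \<mu> \<Upsilon> \<Theta> N =
     measure_of (space N) (sets N)
       (\<lambda>B. ennreal (1 / \<mu>) *
          (\<integral>\<^sup>+\<omega>. (\<integral>\<^sup>+Z. indicator B (\<Theta> \<omega> Z) \<partial>count_space (\<Upsilon> \<omega> \<inter> {0..1})) \<partial>M))"

end

theory Submission
  imports Defs
begin

text \<open>
  Almost surely, the crossings in \<open>[0, 1]\<close> correspond to the pairs of points \<open>(x, y)\<close> of the process,
  ordered by first coordinate, whose common circle centred on the axis has its centre in \<open>[0, 1]\<close>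
  and no point of the process inside. Given two points at \<open>x\<close> and \<open>y\<close>, the disc is empty
  with probability \<open>exp (- \<lambda> \<pi> r\<^sup>2)\<close>, so the expected number of such pairs with angle in \<open>B\<close> is the
  integral of \<open>\<lambda>\<^sup>2 exp (- \<lambda> \<pi> r\<^sup>2)\<close> over the corresponding set of pairs. In the coordinates
  \<open>x = (z - d/2 - u m, m - u d/2)\<close> and \<open>y = (z + d/2 - u m, m + u d/2)\<close>, the centre is \<open>z\<close>,
  \<open>r\<^sup>2 = (d\<^sup>2/4 + m\<^sup>2) (1 + u\<^sup>2)\<close> and the angle is \<open>\<pi> - 2 arctan (2 m / d)\<close>,
  so the integral factorises; integrating out \<open>d\<close> (a Gaussian moment) and then \<open>u\<close> leaves a multiple
  of \<open>sin (t / 2)\<close>.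
\<close>

subsection \<open>Counts and pairs of points of a Poisson process\<close>

text \<open>The hypotheses speak only of counts in fixed bounded Borel sets, whereas the disc that
  must be empty moves with the pair. The formula for the expected number of pairs with an empty disc
  is a two-point Mecke formula, and it has to be derived from independence of counts. For a fixed
  void set and pairs chosen away from it this is a moment computation plus a monotone class
  argument; a moving disc is reached as a limit of regions taking finitely many values. The two
  points of the pair are removed from the region, which costs no area, so that discs larger than the
  one spanned by the pair obey the same formula. Comparing slightly larger discs with the original
  one is what excludes a third point on the circle.

  The integral of \<open>sin (t / 2)\<close> over \<open>(0, 2 pi)\<close> is 4, so the factor
  \<open>sqrt intensity / pi\<close> obtained below corresponds to
  \<open>4 * sqrt intensity / pi\<close> crossings per unit length, in agreement with the
  normalisation of the Palm distribution.\<close>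

definition poisson_weight :: "real \<Rightarrow> nat \<Rightarrow> real" where
  "poisson_weight m k = m ^ k / fact k * exp (- m)"

lemma poisson_weight_nonneg: "0 \<le> m \<Longrightarrow> 0 \<le> poisson_weight m k"
  by (simp add: poisson_weight_def)

text \<open>One factor of the factorial cancels. Each use lowers the index and releases a factor
  \<open>m\<close>, so the mean and the second factorial moment reduce to the total mass 1.\<close>

lemma poisson_weight_Suc: "real (Suc k) * poisson_weight m (Suc k) = m * poisson_weight m k"
  by (simp add: poisson_weight_def field_simps del: of_nat_Suc)

lemma sums_poisson_weight: "poisson_weight m sums 1"
proof -
  have "(\<lambda>k. (m ^ k /\<^sub>R fact k) * exp (- m)) sums (exp m * exp (- m))"
    by (intro sums_mult2 exp_converges)
  then show ?thesis
    by (simp add: poisson_weight_def[abs_def] field_simps flip: exp_add)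
qed

lemma sums_poisson_weight_mean: "(\<lambda>k. real k * poisson_weight m k) sums m"
proof -
  have "(\<lambda>k. real (Suc k) * poisson_weight m (Suc k)) sums (m * 1)"
    unfolding poisson_weight_Suc by (intro sums_mult sums_poisson_weight)
  from sums_Suc[OF this] show ?thesis by simp
qed

lemma sums_poisson_weight_factorial_moment:
  "(\<lambda>k. real (k * (k - 1)) * poisson_weight m k) sums m\<^sup>2"
proof -
  have "real (Suc k * (Suc k - 1)) * poisson_weight m (Suc k) = m * (real k * poisson_weight m k)" for k
  proof -
    have "real (Suc k * (Suc k - 1)) * poisson_weight m (Suc k) =
        real k * (real (Suc k) * poisson_weight m (Suc k))"
      by (simp add: algebra_simps)
    then show ?thesis unfolding poisson_weight_Suc by simp
  qed
  then have "(\<lambda>k. real (Suc k * (Suc k - 1)) * poisson_weight m (Suc k)) sums (m * m)"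
    by (simp only:) (intro sums_mult sums_poisson_weight_mean)
  from sums_Suc[OF this] show ?thesis by (simp add: power2_eq_square)
qed

lemma suminf_ennreal_of_nat_mult:
  assumes "(\<lambda>k. real (a k) * p k) sums s" "\<And>k. 0 \<le> p k"
  shows "(\<Sum>k. of_nat (a k) * ennreal (p k)) = ennreal s"
proof -
  have "(\<Sum>k. of_nat (a k) * ennreal (p k)) = (\<Sum>k. ennreal (real (a k) * p k))"
    by (intro suminf_cong) (simp add: ennreal_mult assms(2) ennreal_of_nat_eq_real_of_nat)
  also have "\<dots> = ennreal s"
    using assms by (subst suminf_ennreal2) (auto simp: sums_iff)
  finally show ?thesis .
qed

context homogeneous_poisson_process
begin

lemma nn_integral_count:
  assumes B: "B \<in> sets borel" "bounded B" and int: "0 \<le> intensity"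
  shows "(\<integral>\<^sup>+\<omega>. f (card (\<Phi> \<omega> \<inter> B)) \<partial>M) =
    (\<Sum>k. f k * ennreal (poisson_weight (intensity * measure lborel B) k))"
proof -
  let ?N = "\<lambda>\<omega>. card (\<Phi> \<omega> \<inter> B)"
  have "(\<integral>\<^sup>+\<omega>. f (?N \<omega>) \<partial>M) = (\<integral>\<^sup>+\<omega>. (\<Sum>k. f k * indicator (?N -` {k} \<inter> space M) \<omega>) \<partial>M)"
  proof (intro nn_integral_cong)
    fix \<omega> assume "\<omega> \<in> space M"
    then have "(\<Sum>k. f k * indicator (?N -` {k} \<inter> space M) \<omega>) = (\<Sum>k\<in>{?N \<omega>}. f k * indicator (?N -` {k} \<inter> space M) \<omega>)"
      by (intro suminf_finite) (auto simp: indicator_def)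
    then show "f (?N \<omega>) = (\<Sum>k. f k * indicator (?N -` {k} \<inter> space M) \<omega>)"
      using \<open>\<omega> \<in> space M\<close> by simp
  qed
  also have "\<dots> = (\<Sum>k. \<integral>\<^sup>+\<omega>. f k * indicator (?N -` {k} \<inter> space M) \<omega> \<partial>M)"
    by (intro nn_integral_suminf borel_measurable_times_ennreal borel_measurable_const
        borel_measurable_indicator measurable_sets[OF measurable_count[OF B]]) simp
  also have "\<dots> = (\<Sum>k. f k * ennreal (poisson_weight (intensity * measure lborel B) k))"
  proof (intro suminf_cong)
    fix k
    have meas: "?N -` {k} \<inter> space M \<in> sets M"
      by (intro measurable_sets[OF measurable_count[OF B]]) simp
    have "(\<integral>\<^sup>+\<omega>. f k * indicator (?N -` {k} \<inter> space M) \<omega> \<partial>M) = f k * emeasure M (?N -` {k} \<inter> space M)"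
      using meas by (simp add: nn_integral_cmult_indicator)
    also have "emeasure M (?N -` {k} \<inter> space M) = emeasure M {\<omega> \<in> space M. ?N \<omega> = k}"
      by (intro arg_cong[of _ _ "emeasure M"]) auto
    finally show "(\<integral>\<^sup>+\<omega>. f k * indicator (?N -` {k} \<inter> space M) \<omega> \<partial>M) =
        f k * ennreal (poisson_weight (intensity * measure lborel B) k)"
      by (simp only: emeasure_eq_measure poisson_count[OF B] poisson_weight_def)
  qed
  finally show ?thesis .
qed

lemma nn_integral_count_mean:
  assumes "B \<in> sets borel" "bounded B" "0 \<le> intensity"
  shows "(\<integral>\<^sup>+\<omega>. of_nat (card (\<Phi> \<omega> \<inter> B)) \<partial>M) = ennreal (intensity * measure lborel B)"
  using assms
  by (simp add: nn_integral_count[where f=of_nat]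
      suminf_ennreal_of_nat_mult[OF sums_poisson_weight_mean] poisson_weight_nonneg)

text \<open>Ordered pairs of distinct points in one set have the expected number that a product of
  two independent counts would have. This is why overlapping factors of a rectangle cause no
  correction term.\<close>

lemma nn_integral_count_factorial_moment:
  assumes "B \<in> sets borel" "bounded B" "0 \<le> intensity"
  shows "(\<integral>\<^sup>+\<omega>. of_nat (card (\<Phi> \<omega> \<inter> B) * (card (\<Phi> \<omega> \<inter> B) - 1)) \<partial>M) =
    ennreal ((intensity * measure lborel B)\<^sup>2)"
  using assms
  by (simp only: nn_integral_count[where f="\<lambda>k. of_nat (k * (k - 1))"]
      suminf_ennreal_of_nat_mult[OF sums_poisson_weight_factorial_moment] poisson_weight_nonneg
      mult_nonneg_nonneg measure_nonneg)

lemma nn_integral_count_void: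
  assumes "B \<in> sets borel" "bounded B" "0 \<le> intensity"
  shows "(\<integral>\<^sup>+\<omega>. of_bool (card (\<Phi> \<omega> \<inter> B) = 0) \<partial>M) = ennreal (exp (- (intensity * measure lborel B)))"
proof -
  let ?p = "poisson_weight (intensity * measure lborel B)"
  have "(\<Sum>k. of_bool (k = 0) * ennreal (?p k)) = (\<Sum>k\<in>{0}. of_bool (k = 0) * ennreal (?p k))"
    by (intro suminf_finite) auto
  then show ?thesis
    using assms by (simp add: nn_integral_count[where f="\<lambda>k. of_bool (k = 0)"] poisson_weight_def)
qed

lemma nn_integral_prod_counts:
  fixes I :: "nat set"
  assumes I: "finite I" and disj: "disjoint_family_on B I"
    and B: "\<And>i. i \<in> I \<Longrightarrow> B i \<in> sets borel \<and> bounded (B i)"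
  shows "(\<integral>\<^sup>+\<omega>. (\<Prod>i\<in>I. (f i (card (\<Phi> \<omega> \<inter> B i)) :: ennreal)) \<partial>M) =
    (\<Prod>i\<in>I. \<integral>\<^sup>+\<omega>. f i (card (\<Phi> \<omega> \<inter> B i)) \<partial>M)"
proof -
  have "indep_vars (\<lambda>_. borel) (\<lambda>i \<omega>. f i (card (\<Phi> \<omega> \<inter> B i))) I"
    by (rule indep_vars_compose2[OF indep_counts[OF I disj B], where Y=f]) simp_all
  with I show ?thesis by (intro indep_vars_nn_integral) simp_all
qed

lemma nn_integral_two_counts_void:
  assumes "B \<in> sets borel" "bounded B" "C \<in> sets borel" "bounded C" "V \<in> sets borel" "bounded V"
    and "B \<inter> C = {}" "B \<inter> V = {}" "C \<inter> V = {}"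
  shows "(\<integral>\<^sup>+\<omega>. f (card (\<Phi> \<omega> \<inter> B)) * g (card (\<Phi> \<omega> \<inter> C)) * of_bool (card (\<Phi> \<omega> \<inter> V) = 0) \<partial>M) =
    (\<integral>\<^sup>+\<omega>. f (card (\<Phi> \<omega> \<inter> B)) \<partial>M) * (\<integral>\<^sup>+\<omega>. g (card (\<Phi> \<omega> \<inter> C)) \<partial>M) *
    (\<integral>\<^sup>+\<omega>. of_bool (card (\<Phi> \<omega> \<inter> V) = 0) \<partial>M)"
proof -
  let ?B = "\<lambda>i::nat. if i = 0 then B else if i = 1 then C else V"
  let ?f = "\<lambda>i::nat. if i = 0 then f else if i = 1 then g else (\<lambda>k. of_bool (k = 0) :: ennreal)"
  have "(\<integral>\<^sup>+\<omega>. (\<Prod>i\<in>{0,1,2}. ?f i (card (\<Phi> \<omega> \<inter> ?B i))) \<partial>M) =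
      (\<Prod>i\<in>{0,1,2}. \<integral>\<^sup>+\<omega>. ?f i (card (\<Phi> \<omega> \<inter> ?B i)) \<partial>M)"
    using assms by (intro nn_integral_prod_counts) (auto simp: disjoint_family_on_def)
  then show ?thesis by (simp add: mult.assoc)
qed

end

section \<open>Ordered pairs of distinct points and their expected number\<close>

definition ordered_pairs :: "'a set \<Rightarrow> ('a \<times> 'a) set \<Rightarrow> ('a \<times> 'a) set" where
  "ordered_pairs S A = {p \<in> A. fst p \<in> S \<and> snd p \<in> S \<and> fst p \<noteq> snd p}"

text \<open>Counting with values in \<open>ennreal\<close> instead of \<open>card\<close> gives
  infinite sets the value infinity and makes countable additivity and monotone limits
  available.\<close>

abbreviation num :: "'a set \<Rightarrow> ennreal" where
  "num \<equiv> emeasure (count_space UNIV)"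

lemma finite_ordered_pairs: "finite (S \<inter> K) \<Longrightarrow> A \<subseteq> K \<times> K \<Longrightarrow> finite (ordered_pairs S A)"
  by (rule finite_subset[of _ "(S \<inter> K) \<times> (S \<inter> K)"]) (auto simp: ordered_pairs_def)

lemma num_Un: "A \<inter> B = {} \<Longrightarrow> num (A \<union> B) = num A + num B"
  by (simp add: plus_emeasure)

text \<open>The factors may overlap, so both are cut along \<open>P \<inter> Q\<close>. The three
  cells are disjoint, which makes independence applicable; only the block of the common cell with
  itself loses its diagonal.\<close>

lemma num_ordered_pairs_Times:
  assumes "finite (S \<inter> P)" "finite (S \<inter> Q)"
  shows "num (ordered_pairs S (P \<times> Q)) =
    of_nat (card (S \<inter> (P - Q))) * of_nat (card (S \<inter> (Q - P))) +
    of_nat (card (S \<inter> (P - Q))) * of_nat (card (S \<inter> (P \<inter> Q))) +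
    of_nat (card (S \<inter> (P \<inter> Q))) * of_nat (card (S \<inter> (Q - P))) +
    of_nat (card (S \<inter> (P \<inter> Q)) * (card (S \<inter> (P \<inter> Q)) - 1))"
proof -
  let ?a = "S \<inter> (P - Q)" and ?b = "S \<inter> (Q - P)" and ?c = "S \<inter> (P \<inter> Q)"
  have fin: "finite ?a" "finite ?b" "finite ?c"
    using assms by (auto elim: finite_subset[rotated])
  have c: "card (?c \<times> ?c - (\<lambda>x. (x, x)) ` ?c) = card ?c * (card ?c - 1)"
    using fin by (subst card_Diff_subset)
      (auto simp: card_image inj_on_def card_cartesian_product diff_mult_distrib2)
  have eq: "ordered_pairs S (P \<times> Q) = ?a \<times> ?b \<union> ?a \<times> ?c \<union> ?c \<times> ?b \<union> (?c \<times> ?c - (\<lambda>x. (x, x)) ` ?c)"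
    by (auto simp: ordered_pairs_def)
  have "num (ordered_pairs S (P \<times> Q)) = num (?a \<times> ?b) + num (?a \<times> ?c) + num (?c \<times> ?b) + num (?c \<times> ?c - (\<lambda>x. (x, x)) ` ?c)"
    unfolding eq by (subst num_Un, force)+ (rule refl)
  also have "\<dots> = of_nat (card (?a \<times> ?b)) + of_nat (card (?a \<times> ?c)) + of_nat (card (?c \<times> ?b)) +
      of_nat (card (?c \<times> ?c - (\<lambda>x. (x, x)) ` ?c))"
    using fin by (simp add: emeasure_count_space_finite)
  finally show ?thesis
    unfolding c by (simp only: card_cartesian_product of_nat_mult)
qed

lemma num_ordered_pairs_Diff:
  assumes "finite (ordered_pairs S (B - A))" "finite (ordered_pairs S A)" "A \<subseteq> B"
  shows "num (ordered_pairs S (B - A)) = num (ordered_pairs S B) - num (ordered_pairs S A)"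
proof -
  have "ordered_pairs S (B - A) = ordered_pairs S B - ordered_pairs S A"
    using assms(3) by (auto simp: ordered_pairs_def)
  moreover have "ordered_pairs S A \<subseteq> ordered_pairs S B"
    using assms(3) by (auto simp: ordered_pairs_def)
  ultimately show ?thesis
    using assms(2) by (simp add: emeasure_Diff)
qed

lemma num_ordered_pairs_UN:
  assumes "disjoint_family A"
  shows "num (ordered_pairs S (\<Union>i. A i)) = (\<Sum>i::nat. num (ordered_pairs S (A i)))"
proof -
  have "ordered_pairs S (\<Union>i. A i) = (\<Union>i. ordered_pairs S (A i))"
    by (auto simp: ordered_pairs_def)
  moreover have "disjoint_family (\<lambda>i. ordered_pairs S (A i))"
    using assms by (auto simp: ordered_pairs_def disjoint_family_on_def)
  ultimately show ?thesis by (simp add: suminf_emeasure)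
qed

context homogeneous_poisson_process
begin

lemma void_eq_of_bool:
  assumes "\<omega> \<in> space M" "bounded V"
  shows "card (\<Phi> \<omega> \<inter> V) = 0 \<longleftrightarrow> \<Phi> \<omega> \<inter> V = {}"
  using locally_finite[OF assms] by simp

text \<open>Each of the four blocks involves at most two disjoint cells and the disjoint set
  \<open>V\<close>, so its expectation factorises. The sum of the four products recombines to the
  product of the measures of \<open>P\<close> and \<open>Q\<close>.\<close>

lemma
  assumes P: "P \<in> sets borel" "bounded P" and Q: "Q \<in> sets borel" "bounded Q"
    and V: "V \<in> sets borel" "bounded V" and disj: "P \<inter> V = {}" "Q \<inter> V = {}"
    and int: "0 \<le> intensity"
  shows measurable_pairs_void_Times:
      "(\<lambda>\<omega>. num (ordered_pairs (\<Phi> \<omega>) (P \<times> Q)) * of_bool (\<Phi> \<omega> \<inter> V = {})) \<in> borel_measurable M"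
    and nn_integral_pairs_void_Times:
      "(\<integral>\<^sup>+\<omega>. num (ordered_pairs (\<Phi> \<omega>) (P \<times> Q)) * of_bool (\<Phi> \<omega> \<inter> V = {}) \<partial>M) =
        ennreal (intensity\<^sup>2 * exp (- (intensity * measure lborel V))) * emeasure lborel (P \<times> Q)"
proof -
  let ?N = "\<lambda>B \<omega>. card (\<Phi> \<omega> \<inter> B)"
  let ?v = "\<lambda>\<omega>. of_bool (?N V \<omega> = 0) :: ennreal"
  have B: "P - Q \<in> sets borel" "bounded (P - Q)" "Q - P \<in> sets borel" "bounded (Q - P)"
    "P \<inter> Q \<in> sets borel" "bounded (P \<inter> Q)" "{} \<in> sets borel" "bounded {}"
    using P Q by (auto intro: bounded_subset)
  have [measurable]: "?N (P - Q) \<in> measurable M (count_space UNIV)"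
      "?N (Q - P) \<in> measurable M (count_space UNIV)"
      "?N (P \<inter> Q) \<in> measurable M (count_space UNIV)" "?N V \<in> measurable M (count_space UNIV)"
    using B V by (auto intro: measurable_count)
  let ?f = "\<lambda>\<omega>. of_nat (?N (P - Q) \<omega>) * of_nat (?N (Q - P) \<omega>) * ?v \<omega> +
      of_nat (?N (P - Q) \<omega>) * of_nat (?N (P \<inter> Q) \<omega>) * ?v \<omega> +
      of_nat (?N (P \<inter> Q) \<omega>) * of_nat (?N (Q - P) \<omega>) * ?v \<omega> +
      of_nat (?N (P \<inter> Q) \<omega> * (?N (P \<inter> Q) \<omega> - 1)) * 1 * ?v \<omega>"
  have eq: "num (ordered_pairs (\<Phi> \<omega>) (P \<times> Q)) * of_bool (\<Phi> \<omega> \<inter> V = {}) = ?f \<omega>"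
    if "\<omega> \<in> space M" for \<omega>
    using that locally_finite[OF that P(2)] locally_finite[OF that Q(2)]
    unfolding void_eq_of_bool[OF that V(2)] by (simp add: num_ordered_pairs_Times distrib_right)
  have "?f \<in> borel_measurable M" by measurable
  then show "(\<lambda>\<omega>. num (ordered_pairs (\<Phi> \<omega>) (P \<times> Q)) * of_bool (\<Phi> \<omega> \<inter> V = {})) \<in> borel_measurable M"
    by (subst measurable_cong[OF eq])
  let ?l = "\<lambda>B. intensity * measure lborel B"
  let ?e = "exp (- ?l V)"
  have 1: "(\<integral>\<^sup>+\<omega>. of_nat (?N (P - Q) \<omega>) * of_nat (?N (Q - P) \<omega>) * ?v \<omega> \<partial>M) =
      ennreal (?l (P - Q)) * ennreal (?l (Q - P)) * ennreal ?e"
    using B V disj int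
    by (subst nn_integral_two_counts_void[where f=of_nat and g=of_nat])
      (auto simp: nn_integral_count_mean nn_integral_count_void)
  have 2: "(\<integral>\<^sup>+\<omega>. of_nat (?N (P - Q) \<omega>) * of_nat (?N (P \<inter> Q) \<omega>) * ?v \<omega> \<partial>M) =
      ennreal (?l (P - Q)) * ennreal (?l (P \<inter> Q)) * ennreal ?e"
    using B V disj int
    by (subst nn_integral_two_counts_void[where f=of_nat and g=of_nat])
      (auto simp: nn_integral_count_mean nn_integral_count_void)
  have 3: "(\<integral>\<^sup>+\<omega>. of_nat (?N (P \<inter> Q) \<omega>) * of_nat (?N (Q - P) \<omega>) * ?v \<omega> \<partial>M) =
      ennreal (?l (P \<inter> Q)) * ennreal (?l (Q - P)) * ennreal ?e"
    using B V disj int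
    by (subst nn_integral_two_counts_void[where f=of_nat and g=of_nat])
      (auto simp: nn_integral_count_mean nn_integral_count_void)
  have 4: "(\<integral>\<^sup>+\<omega>. of_nat (?N (P \<inter> Q) \<omega> * (?N (P \<inter> Q) \<omega> - 1)) * 1 * ?v \<omega> \<partial>M) =
      ennreal ((?l (P \<inter> Q))\<^sup>2) * 1 * ennreal ?e"
  proof -
    have "(\<integral>\<^sup>+\<omega>. of_nat (?N (P \<inter> Q) \<omega> * (?N (P \<inter> Q) \<omega> - 1)) * 1 * ?v \<omega> \<partial>M) =
      (\<integral>\<^sup>+\<omega>. of_nat (?N (P \<inter> Q) \<omega> * (?N (P \<inter> Q) \<omega> - 1)) \<partial>M) * (\<integral>\<^sup>+\<omega>. 1 \<partial>M) * (\<integral>\<^sup>+\<omega>. ?v \<omega> \<partial>M)"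
      using B V disj
      \<comment> \<open>Only one cell occurs in this block; the empty set with constant weight 1
        fills the place of the second.\<close>
      by (intro nn_integral_two_counts_void[where f="\<lambda>k. of_nat (k * (k - 1))" and g="\<lambda>_. 1" and C="{}"]) auto
    also have "\<dots> = ennreal ((?l (P \<inter> Q))\<^sup>2) * 1 * ennreal ?e"
      using B V int
      by (simp only: nn_integral_count_factorial_moment nn_integral_count_void nn_integral_const
          emeasure_space_1 mult_1)
    finally show ?thesis .
  qed
  have fm: "A \<in> fmeasurable lborel" if "A \<in> sets borel" "bounded A" for A :: "'a set"
    using that emeasure_bounded_finite[of A] by (intro fmeasurableI) simp_all
  have lP: "measure lborel P = measure lborel (P - Q) + measure lborel (P \<inter> Q)"
    using measure_Un2[of "P \<inter> Q" lborel P] fm[OF P] fm[OF B(5,6)]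
    by (simp add: Un_absorb1 Diff_Int)
  have lQ: "measure lborel Q = measure lborel (Q - P) + measure lborel (P \<inter> Q)"
    using measure_Un2[of "P \<inter> Q" lborel Q] fm[OF Q] fm[OF B(5,6)]
    by (simp add: Un_absorb1 Diff_Int)
  have "(\<integral>\<^sup>+\<omega>. num (ordered_pairs (\<Phi> \<omega>) (P \<times> Q)) * of_bool (\<Phi> \<omega> \<inter> V = {}) \<partial>M) = integral\<^sup>N M ?f"
    by (rule nn_integral_cong) (rule eq)
  also have "\<dots> = ennreal (?l (P - Q)) * ennreal (?l (Q - P)) * ennreal ?e +
      ennreal (?l (P - Q)) * ennreal (?l (P \<inter> Q)) * ennreal ?e +
      ennreal (?l (P \<inter> Q)) * ennreal (?l (Q - P)) * ennreal ?e +
      ennreal ((?l (P \<inter> Q))\<^sup>2) * 1 * ennreal ?e"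
    unfolding 1[symmetric] 2[symmetric] 3[symmetric] 4[symmetric]
    by (simp add: nn_integral_add)
  also have "\<dots> = ennreal (intensity\<^sup>2 * ?e * (measure lborel P * measure lborel Q))"
    using int unfolding lP lQ
    by (simp add: ennreal_mult[symmetric] ennreal_plus[symmetric] power2_eq_square algebra_simps
        del: ennreal_plus)
  also have "\<dots> = ennreal (intensity\<^sup>2 * ?e) * emeasure lborel (P \<times> Q)"
  proof -
    have "emeasure lborel (P \<times> Q) = emeasure lborel P * emeasure lborel Q"
      using P Q by (simp add: lborel_prod[symmetric] lborel.emeasure_pair_measure_Times)
    also have "\<dots> = ennreal (measure lborel P * measure lborel Q)"
      using fm[OF P] fm[OF Q] by (simp add: emeasure_eq_measure2 ennreal_mult)
    finally show ?thesis using int by (simp add: ennreal_mult)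
  qed
  finally show "(\<integral>\<^sup>+\<omega>. num (ordered_pairs (\<Phi> \<omega>) (P \<times> Q)) * of_bool (\<Phi> \<omega> \<inter> V = {}) \<partial>M) =
        ennreal (intensity\<^sup>2 * ?e) * emeasure lborel (P \<times> Q)" .
qed

text \<open>A Dynkin argument: rectangles are closed under intersection and generate the Borel sets
  of pairs. The bounded \<open>K\<close> keeps counts and expectations finite, as needed to subtract
  in the complement step. Measurability is part of the induction claim because it passes through the
  same steps.\<close>

lemma pairs_void:
  assumes K: "K \<in> sets borel" "bounded K"
    and V: "V \<in> sets borel" "bounded V" and disj: "K \<inter> V = {}" and int: "0 \<le> intensity"
    and A: "A \<in> sets borel"
  shows "(\<lambda>\<omega>. num (ordered_pairs (\<Phi> \<omega>) (A \<inter> K \<times> K)) * of_bool (\<Phi> \<omega> \<inter> V = {})) \<in> borel_measurable M \<and>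
      (\<integral>\<^sup>+\<omega>. num (ordered_pairs (\<Phi> \<omega>) (A \<inter> K \<times> K)) * of_bool (\<Phi> \<omega> \<inter> V = {}) \<partial>M) =
        ennreal (intensity\<^sup>2 * exp (- (intensity * measure lborel V))) * emeasure lborel (A \<inter> K \<times> K)"
    (is "?meas A \<and> ?int A")
proof -
  let ?H = "\<lambda>A \<omega>. num (ordered_pairs (\<Phi> \<omega>) (A \<inter> K \<times> K)) * of_bool (\<Phi> \<omega> \<inter> V = {})"
  let ?c = "ennreal (intensity\<^sup>2 * exp (- (intensity * measure lborel V)))"
  let ?G = "{a \<times> b | a b. a \<in> sets (borel :: 'a measure) \<and> b \<in> sets (borel :: 'a measure)}"
  have sets_eq: "sets (borel :: ('a \<times> 'a) measure) = sigma_sets UNIV ?G"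
    by (subst borel_prod[symmetric]) (simp add: sets_pair_measure)
  have KK: "K \<times> K \<in> sets borel"
    using K by (subst borel_prod[symmetric]) simp
  have "bounded (K \<times> K)" using K(2) K(2) by (rule bounded_Times)
  then have fin: "emeasure lborel (B \<inter> K \<times> K) < \<infinity>" for B
    by (intro emeasure_bounded_finite) (auto intro: bounded_subset)
  have rectangle: "?meas (a \<times> b) \<and> ?int (a \<times> b)" if "a \<in> sets borel" "b \<in> sets borel" for a b
  proof -
    have *: "a \<times> b \<inter> K \<times> K = (a \<inter> K) \<times> (b \<inter> K)" by auto
    show ?thesis
      unfolding * using that K V disj int
      by (intro conjI measurable_pairs_void_Times nn_integral_pairs_void_Times) (auto intro: bounded_subset)
  qed
  have "?G \<subseteq> Pow UNIV" "A \<in> sigma_sets UNIV ?G" using A sets_eq by auto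
  with Int_stable_pair_measure_generator[of borel borel] show "?meas A \<and> ?int A"
  proof (induction rule: sigma_sets_induct_disjoint)
    case (basic A)
    then show ?case using rectangle by auto
  next
    case empty
    show ?case by (simp add: ordered_pairs_def)
  next
    case (compl A)
    have fin_pairs: "finite (ordered_pairs (\<Phi> \<omega>) (B \<inter> K \<times> K))" if "\<omega> \<in> space M" for B \<omega>
      using locally_finite[OF that K(2)] by (rule finite_ordered_pairs) auto
    have eq: "?H (UNIV - A) \<omega> = ?H UNIV \<omega> - ?H A \<omega>" if "\<omega> \<in> space M" for \<omega>
    proof -
      have "(UNIV - A) \<inter> K \<times> K = K \<times> K - A \<inter> K \<times> K" by auto
      then show ?thesis
        using num_ordered_pairs_Diff[of "\<Phi> \<omega>" "K \<times> K" "A \<inter> K \<times> K"]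
          fin_pairs[OF that, of A] fin_pairs[OF that, of "UNIV - A"]
        by (cases "\<Phi> \<omega> \<inter> V = {}") (simp_all del: emeasure_count_space_finite)
    qed
    have meas: "?H UNIV \<in> borel_measurable M" "?H A \<in> borel_measurable M"
      using rectangle[of UNIV UNIV] compl by simp_all
    have "?meas (UNIV - A)"
      using meas by (subst measurable_cong[OF eq]) auto
    moreover have "?int (UNIV - A)"
    proof -
      have "integral\<^sup>N M (?H (UNIV - A)) = (\<integral>\<^sup>+\<omega>. ?H UNIV \<omega> - ?H A \<omega> \<partial>M)"
        by (rule nn_integral_cong) (rule eq)
      also have "\<dots> = integral\<^sup>N M (?H UNIV) - integral\<^sup>N M (?H A)"
      proof (intro nn_integral_diff AE_I2)
        show "integral\<^sup>N M (?H A) \<noteq> \<infinity>"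
          using compl fin[of A] by (simp add: ennreal_mult_eq_top_iff less_top[symmetric])
        show "?H A \<omega> \<le> ?H UNIV \<omega>" for \<omega>
          by (intro mult_right_mono emeasure_mono) (auto simp: ordered_pairs_def)
      qed (use meas in auto)
      also have "\<dots> = ?c * (emeasure lborel (K \<times> K) - emeasure lborel (A \<inter> K \<times> K))"
        using rectangle[of UNIV UNIV] compl fin[of UNIV] by (simp add: ennreal_right_diff_distrib)
      also have "emeasure lborel (K \<times> K) - emeasure lborel (A \<inter> K \<times> K) = emeasure lborel (K \<times> K - A \<inter> K \<times> K)"
        using compl.hyps KK fin[of A] sets_eq by (subst emeasure_Diff) auto
      also have "K \<times> K - A \<inter> K \<times> K = (UNIV - A) \<inter> K \<times> K" by auto
      finally show ?thesis .
    qed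
    ultimately show ?case by blast
  next
    case (union A)
    have eq: "?H (\<Union>i. A i) \<omega> = (\<Sum>i. ?H (A i) \<omega>)" for \<omega>
    proof -
      have UN: "(\<Union>i. A i) \<inter> K \<times> K = (\<Union>i. A i \<inter> K \<times> K)" by auto
      have "disjoint_family (\<lambda>i. A i \<inter> K \<times> K)"
        using union(1) by (auto simp: disjoint_family_on_def)
      then show ?thesis unfolding UN by (subst num_ordered_pairs_UN) simp_all
    qed
    have meas: "?H (A i) \<in> borel_measurable M" for i using union(3) by blast
    have int: "integral\<^sup>N M (?H (A i)) = ?c * emeasure lborel (A i \<inter> K \<times> K)" for i using union(3) by blast
    have "?meas (\<Union>i. A i)" unfolding eq using meas by measurable
    moreover have "?int (\<Union>i. A i)"
    proof -
      have "integral\<^sup>N M (?H (\<Union>i. A i)) = (\<Sum>i. ?c * emeasure lborel (A i \<inter> K \<times> K))"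
        unfolding eq int[symmetric] by (rule nn_integral_suminf) (rule meas)
      also have "\<dots> = ?c * emeasure lborel (\<Union>i. A i \<inter> K \<times> K)"
      proof -
        have "A i \<in> sets borel" for i
          using union(2) sets_eq by blast
        then have "A i \<inter> K \<times> K \<in> sets lborel" for i
          using KK by simp
        moreover have "disjoint_family (\<lambda>i. A i \<inter> K \<times> K)"
          using union(1) by (auto simp: disjoint_family_on_def)
        ultimately show ?thesis by (subst suminf_emeasure[symmetric]) auto
      qed
      also have "(\<Union>i. A i \<inter> K \<times> K) = (\<Union>i. A i) \<inter> K \<times> K" by auto
      finally show ?thesis .
    qed
    ultimately show ?case by blast
  qed
qed

end

subsection \<open>Pairs of points with a void region\<close>

text \<open>Centres run through a countable dense set and radii through the reciprocals of positive
  integers, both coded in one index. The bound is on \<open>2 * q k\<close> because a ball of radius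
  \<open>q k\<close> containing \<open>w\<close> stays within \<open>2 * q k\<close> of
  \<open>w\<close>.\<close>

lemma countable_balls_cover:
  shows "\<exists>(c :: nat \<Rightarrow> 'a::{metric_space, second_countable_topology}) q. (\<forall>k. 0 < q k) \<and> (\<forall>w e. 0 < e \<longrightarrow> (\<exists>k. w \<in> ball (c k) (q k) \<and> 2 * q k \<le> e))"
proof -
  obtain D :: "'a set" where D: "countable D" "\<And>X. open X \<Longrightarrow> X \<noteq> {} \<Longrightarrow> \<exists>d\<in>D. d \<in> X"
    by (rule countable_dense_setE) blast
  from D(2)[of UNIV] have "D \<noteq> {}" by auto
  define c where "c k = from_nat_into D (fst (prod_decode k))" for k
  define q where "q k = 1 / real (Suc (snd (prod_decode k)))" for k
  show ?thesis
  proof (intro exI[of _ c] exI[of _ q] conjI allI impI)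
    show "0 < q k" for k by (simp add: q_def)
    fix w :: 'a and e :: real assume e: "0 < e"
    then obtain j where j: "1 / real (Suc j) < e / 2" using nat_approx_posE[of "e / 2"] by auto
    obtain d where d: "d \<in> D" "d \<in> ball w (1 / real (Suc j))"
      using D(2)[of "ball w (1 / real (Suc j))"] by auto
    obtain i where i: "from_nat_into D i = d"
      using from_nat_into_surj[OF D(1) d(1)] by auto
    show "\<exists>k. w \<in> ball (c k) (q k) \<and> 2 * q k \<le> e"
      using d(2) i j by (intro exI[of _ "prod_encode (i, j)"]) (auto simp: c_def q_def dist_commute)
  qed
qed

context homogeneous_poisson_process
begin

definition void_pairs :: "('a \<times> 'a) set \<Rightarrow> ('a \<times> 'a \<Rightarrow> 'a set) \<Rightarrow> 'w \<Rightarrow> ('a \<times> 'a) set" where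
  "void_pairs A D \<omega> = {p \<in> ordered_pairs (\<Phi> \<omega>) A. \<Phi> \<omega> \<inter> D p = {}}"

text \<open>
  The region that has to be void depends on the pair. Building it up from countably many fixed sets
  \<open>U k\<close>, each used for the pairs in \<open>R k\<close>, means that after finitely many steps only finitely many
  fixed regions occur, to which independence of the counts applies.
\<close>

context
  fixes U :: "nat \<Rightarrow> 'a set" and R :: "nat \<Rightarrow> ('a \<times> 'a) set"
  assumes U: "\<And>k. U k \<in> sets borel" "\<And>k. bounded (U k)"
    and R: "\<And>k. R k \<in> sets borel" "\<And>k x y. (x, y) \<in> R k \<Longrightarrow> x \<notin> U k \<and> y \<notin> U k"
    and int: "0 \<le> intensity"
begin

definition partial_region :: "nat \<Rightarrow> 'a \<times> 'a \<Rightarrow> 'a set" where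
  "partial_region n p = (\<Union>k\<in>{k. k < n \<and> p \<in> R k}. U k)"

lemma partial_region_0: "partial_region 0 p = {}"
  by (simp add: partial_region_def)

lemma partial_region_Suc:
  "partial_region (Suc n) p = (if p \<in> R n then U n else {}) \<union> partial_region n p"
  by (auto simp: partial_region_def less_Suc_eq)

lemma sets_partial_region: "partial_region n p \<in> sets borel"
  unfolding partial_region_def using U(1) by auto

text \<open>As \<open>p\<close> varies only finitely many regions occur, each on a Borel set. The
  additional set \<open>V\<close> makes the induction go through, since on \<open>R n\<close> it
  absorbs \<open>U n\<close>.\<close>

lemma measurable_measure_partial_region:
  "(\<lambda>p. measure lborel (V \<union> partial_region n p)) \<in> borel_measurable borel"
proof (induction n arbitrary: V)
  case 0
  then show ?case by (simp add: partial_region_0)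
next
  case (Suc n)
  have "(\<lambda>p. measure lborel (V \<union> partial_region (Suc n) p)) =
      (\<lambda>p. if p \<in> R n then measure lborel ((V \<union> U n) \<union> partial_region n p)
        else measure lborel (V \<union> partial_region n p))"
    by (auto simp: partial_region_Suc Un_assoc fun_eq_iff)
  also have "\<dots> \<in> borel_measurable borel"
    using R(1)[of n] by (intro measurable_If_set Suc.IH) simp_all
  finally show ?case .
qed

text \<open>Induction on \<open>n\<close>, splitting \<open>A\<close> along \<open>R n\<close>: on
  \<open>A \<inter> R n\<close> the set \<open>U n\<close> joins the fixed void set
  \<open>V\<close>, on the rest nothing changes. Pairs in \<open>R n\<close> avoid
  \<open>U n\<close>, so the requirement that \<open>A\<close> stay away from the void set is
  preserved. For \<open>n = 0\<close> the region is fixed.\<close>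

lemma void_pairs_partial_region:
  assumes K: "K \<in> sets borel" "bounded K" and V: "V \<in> sets borel" "bounded V"
    and A: "A \<in> sets borel" "A \<subseteq> (K - V) \<times> (K - V)"
  shows "(\<lambda>\<omega>. num (void_pairs A (\<lambda>p. V \<union> partial_region n p) \<omega>)) \<in> borel_measurable M \<and>
    (\<integral>\<^sup>+\<omega>. num (void_pairs A (\<lambda>p. V \<union> partial_region n p) \<omega>) \<partial>M) =
    (\<integral>\<^sup>+p. ennreal (intensity\<^sup>2 * exp (- (intensity * measure lborel (V \<union> partial_region n p)))) *
       indicator A p \<partial>lborel)"
  using V A
proof (induction n arbitrary: V A)
  case (0 V A)
  have "A \<inter> (K - V) \<times> (K - V) = A" using 0(4) by auto
  moreover have "void_pairs A (\<lambda>p. V \<union> partial_region 0 p) \<omega> =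
      (if \<Phi> \<omega> \<inter> V = {} then ordered_pairs (\<Phi> \<omega>) A else {})" for \<omega>
    by (auto simp: void_pairs_def partial_region_0)
  then have "num (void_pairs A (\<lambda>p. V \<union> partial_region 0 p) \<omega>) =
      num (ordered_pairs (\<Phi> \<omega>) A) * of_bool (\<Phi> \<omega> \<inter> V = {})" for \<omega>
    by simp
  ultimately show ?case
    using pairs_void[of "K - V" V A] 0 K int
    by (auto simp: nn_integral_cmult_indicator partial_region_0)
next
  case (Suc n V A)
  let ?w = "\<lambda>p. ennreal (intensity\<^sup>2 * exp (- (intensity * measure lborel (V \<union> partial_region (Suc n) p))))"
  let ?w1 = "\<lambda>p. ennreal (intensity\<^sup>2 * exp (- (intensity * measure lborel ((V \<union> U n) \<union> partial_region n p))))"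
  let ?w2 = "\<lambda>p. ennreal (intensity\<^sup>2 * exp (- (intensity * measure lborel (V \<union> partial_region n p))))"
  note [measurable] = Suc.prems(3) R(1)[of n] measurable_measure_partial_region
  have 1: "(\<lambda>\<omega>. num (void_pairs (A \<inter> R n) (\<lambda>p. (V \<union> U n) \<union> partial_region n p) \<omega>)) \<in> borel_measurable M \<and>
    (\<integral>\<^sup>+\<omega>. num (void_pairs (A \<inter> R n) (\<lambda>p. (V \<union> U n) \<union> partial_region n p) \<omega>) \<partial>M) =
      (\<integral>\<^sup>+p. ?w1 p * indicator (A \<inter> R n) p \<partial>lborel)"
    using Suc.prems U[of n] R(1)[of n] R(2)[of _ _ n] by (intro Suc.IH) auto
  have 2: "(\<lambda>\<omega>. num (void_pairs (A - R n) (\<lambda>p. V \<union> partial_region n p) \<omega>)) \<in> borel_measurable M \<and>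
    (\<integral>\<^sup>+\<omega>. num (void_pairs (A - R n) (\<lambda>p. V \<union> partial_region n p) \<omega>) \<partial>M) =
      (\<integral>\<^sup>+p. ?w2 p * indicator (A - R n) p \<partial>lborel)"
    using Suc.prems R(1)[of n] by (intro Suc.IH) auto
  have split: "void_pairs A (\<lambda>p. V \<union> partial_region (Suc n) p) \<omega> =
      void_pairs (A \<inter> R n) (\<lambda>p. (V \<union> U n) \<union> partial_region n p) \<omega> \<union>
      void_pairs (A - R n) (\<lambda>p. V \<union> partial_region n p) \<omega>" for \<omega>
    by (auto simp: void_pairs_def ordered_pairs_def partial_region_Suc split: if_splits)
  have eq: "num (void_pairs A (\<lambda>p. V \<union> partial_region (Suc n) p) \<omega>) =
      num (void_pairs (A \<inter> R n) (\<lambda>p. (V \<union> U n) \<union> partial_region n p) \<omega>) +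
      num (void_pairs (A - R n) (\<lambda>p. V \<union> partial_region n p) \<omega>)" for \<omega>
    unfolding split by (rule num_Un) (auto simp: void_pairs_def ordered_pairs_def)
  have "(\<integral>\<^sup>+p. ?w p * indicator A p \<partial>lborel) =
      (\<integral>\<^sup>+p. ?w1 p * indicator (A \<inter> R n) p + ?w2 p * indicator (A - R n) p \<partial>lborel)"
    by (intro nn_integral_cong) (auto simp: partial_region_Suc Un_assoc split: split_indicator)
  also have "\<dots> = (\<integral>\<^sup>+p. ?w1 p * indicator (A \<inter> R n) p \<partial>lborel) + (\<integral>\<^sup>+p. ?w2 p * indicator (A - R n) p \<partial>lborel)"
    by (rule nn_integral_add) measurable
  finally have "(\<integral>\<^sup>+p. ?w p * indicator A p \<partial>lborel) = \<dots>" .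
  then show ?case
    unfolding eq using 1 2 by (auto simp: nn_integral_add intro!: borel_measurable_add)
qed

text \<open>The partial regions increase to \<open>D p\<close>, hence the sets of pairs decrease.
  Continuity from above needs finiteness, both of the pairs for each outcome and of the first
  expectation, and the bounded \<open>K\<close> supplies both.\<close>

lemma void_pairs_UN_bounded:
  assumes K: "K \<in> sets borel" "bounded K"
    and A: "A \<in> sets borel" "A \<subseteq> K \<times> K"
    and D: "\<And>p. D p = (\<Union>k\<in>{k. p \<in> R k}. U k)" "\<And>p. bounded (D p)"
  shows "(\<lambda>p. measure lborel (D p)) \<in> borel_measurable borel \<and>
    (\<lambda>\<omega>. num (void_pairs A D \<omega>)) \<in> borel_measurable M \<and>
    (\<integral>\<^sup>+\<omega>. num (void_pairs A D \<omega>) \<partial>M) =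
    (\<integral>\<^sup>+p. ennreal (intensity\<^sup>2 * exp (- (intensity * measure lborel (D p)))) * indicator A p \<partial>lborel)"
proof -
  let ?F = "\<lambda>n \<omega>. num (void_pairs A (partial_region n) \<omega>)"
  let ?w = "\<lambda>n p. ennreal (intensity\<^sup>2 * exp (- (intensity * measure lborel (partial_region n p)))) * indicator A p"
  let ?W = "\<lambda>p. ennreal (intensity\<^sup>2 * exp (- (intensity * measure lborel (D p)))) * indicator A p"
  have F: "?F n \<in> borel_measurable M" "integral\<^sup>N M (?F n) = integral\<^sup>N lborel (?w n)" for n
    using void_pairs_partial_region[OF K, of "{}" A n] A by auto
  have mw: "(\<lambda>p. measure lborel (partial_region n p)) \<in> borel_measurable borel" for n
    using measurable_measure_partial_region[of "{}" n] by simp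
  have inc: "incseq (\<lambda>n. partial_region n p)" for p
    by (intro monoI) (force simp: partial_region_def)
  have DUN: "D p = (\<Union>n. partial_region n p)" for p
    by (auto simp: D partial_region_def)
  have lim: "(\<lambda>n. measure lborel (partial_region n p)) \<longlonglongrightarrow> measure lborel (D p)" for p
    unfolding DUN using inc emeasure_bounded_finite[OF D(2)[of p]]
    by (intro Lim_measure_incseq) (auto simp flip: DUN intro: sets_partial_region)
  have mD: "(\<lambda>p. measure lborel (D p)) \<in> borel_measurable borel"
    by (rule borel_measurable_LIMSEQ_metric[OF mw lim])
  have decw: "decseq ?w"
  proof (intro decseq_SucI le_funI mult_right_mono ennreal_leI mult_left_mono)
    fix n p
    have "bounded (partial_region (Suc n) p)"
      by (rule bounded_subset[OF D(2)[of p]]) (auto simp: DUN)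
    then have "partial_region (Suc n) p \<in> fmeasurable lborel"
      using sets_partial_region by (intro fmeasurableI emeasure_bounded_finite) simp_all
    then have "measure lborel (partial_region n p) \<le> measure lborel (partial_region (Suc n) p)"
      using sets_partial_region by (intro measure_mono_fmeasurable) (auto simp: partial_region_Suc)
    then show "exp (- (intensity * measure lborel (partial_region (Suc n) p)))
      \<le> exp (- (intensity * measure lborel (partial_region n p)))"
      using int by (simp add: mult_left_mono)
  qed simp_all
  have infw: "(INF n. ?w n p) = ?W p" for p
  proof (rule LIMSEQ_unique[OF LIMSEQ_INF])
    show "decseq (\<lambda>n. ?w n p)"
      by (rule decseq_SucI) (rule le_funD[OF decseq_SucD[OF decw]])
    show "(\<lambda>n. ?w n p) \<longlonglongrightarrow> ?W p"
      by (cases "p \<in> A") (auto intro!: tendsto_ennrealI tendsto_intros lim)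
  qed
  have fin: "finite (void_pairs A (partial_region n) \<omega>)" if "\<omega> \<in> space M" for n \<omega>
    by (rule finite_subset[OF _ finite_ordered_pairs[OF locally_finite[OF that K(2)] A(2)]])
      (auto simp: void_pairs_def)
  have INT: "void_pairs A D \<omega> = (\<Inter>n. void_pairs A (partial_region n) \<omega>)" for \<omega>
    by (auto simp: void_pairs_def DUN)
  have dec: "decseq (\<lambda>n. void_pairs A (partial_region n) \<omega>)" for \<omega>
  proof (intro decseq_SucI)
    fix n show "void_pairs A (partial_region (Suc n)) \<omega> \<subseteq> void_pairs A (partial_region n) \<omega>"
      by (auto simp: void_pairs_def partial_region_Suc)
  qed
  have infF: "num (void_pairs A D \<omega>) = (INF n. ?F n \<omega>)" if "\<omega> \<in> space M" for \<omega>
    unfolding INT using fin[OF that] dec by (intro INF_emeasure_decseq[symmetric]) auto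
  have "(\<lambda>\<omega>. num (void_pairs A D \<omega>)) \<in> borel_measurable M"
    using F(1) by (subst measurable_cong[OF infF]) auto
  moreover have "(\<integral>\<^sup>+\<omega>. num (void_pairs A D \<omega>) \<partial>M) = (\<integral>\<^sup>+p. ?W p \<partial>lborel)"
  proof -
    \<comment> \<open>The region is empty at stage 0, so the integrand is the constant
      \<open>intensity\<^sup>2\<close> on the bounded set \<open>A\<close>.\<close>
    have fin0: "integral\<^sup>N lborel (?w 0) < \<infinity>"
      using A emeasure_bounded_finite[of A] bounded_subset[OF bounded_Times[OF K(2) K(2)] A(2)]
      by (simp add: partial_region_0 nn_integral_cmult_indicator ennreal_mult_less_top)
    have "(\<integral>\<^sup>+\<omega>. num (void_pairs A D \<omega>) \<partial>M) = (\<integral>\<^sup>+\<omega>. (INF n. ?F n \<omega>) \<partial>M)"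
      by (rule nn_integral_cong) (rule infF)
    also have "\<dots> = (INF n. integral\<^sup>N M (?F n))"
    proof (rule nn_integral_monotone_convergence_INF_decseq[where i=0])
      show "decseq ?F"
        by (intro decseq_SucI le_funI emeasure_mono decseq_SucD[OF dec]) simp
      show "integral\<^sup>N M (?F 0) < \<infinity>"
        unfolding F(2) by (rule fin0)
    qed (rule F(1))
    also have "\<dots> = (INF n. integral\<^sup>N lborel (?w n))" by (simp only: F(2))
    also have "\<dots> = (\<integral>\<^sup>+p. (INF n. ?w n p) \<partial>lborel)"
      using fin0 mw A(1) decw
      by (intro nn_integral_monotone_convergence_INF_decseq[where i=0, symmetric]) auto
    finally show ?thesis by (simp only: infw)
  qed
  ultimately show ?thesis using mD by blast
qed

text \<open>Exhausting the pairs by products of growing balls removes the boundedness of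
  \<open>A\<close>. The limit is now from below and needs no finiteness; on the right it is
  continuity of a measure given by a density.\<close>

lemma void_pairs_UN:
  assumes A: "A \<in> sets borel"
    and D: "\<And>p. D p = (\<Union>k\<in>{k. p \<in> R k}. U k)" "\<And>p. bounded (D p)"
  shows "(\<lambda>\<omega>. num (void_pairs A D \<omega>)) \<in> borel_measurable M \<and>
    (\<integral>\<^sup>+\<omega>. num (void_pairs A D \<omega>) \<partial>M) =
    (\<integral>\<^sup>+p. ennreal (intensity\<^sup>2 * exp (- (intensity * measure lborel (D p)))) * indicator A p \<partial>lborel)"
proof -
  let ?w = "\<lambda>p. ennreal (intensity\<^sup>2 * exp (- (intensity * measure lborel (D p))))"
  define K where "K n = ball (0::'a) (real n)" for n
  define AK where "AK n = A \<inter> K n \<times> K n" for n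
  have sAK: "AK n \<in> sets borel" for n
    unfolding AK_def K_def by (intro sets.Int[OF A] borel_open open_Times) auto
  have b: "(\<lambda>p. measure lborel (D p)) \<in> borel_measurable borel \<and>
    (\<lambda>\<omega>. num (void_pairs (AK n) D \<omega>)) \<in> borel_measurable M \<and>
    (\<integral>\<^sup>+\<omega>. num (void_pairs (AK n) D \<omega>) \<partial>M) = (\<integral>\<^sup>+p. ?w p * indicator (AK n) p \<partial>lborel)" for n
    using sAK D by (intro void_pairs_UN_bounded[where K="K n"]) (auto simp: K_def AK_def)
  then have mw: "(\<lambda>p. measure lborel (D p)) \<in> borel_measurable borel" by blast
  have incAK: "incseq AK"
    by (intro monoI) (auto simp: AK_def K_def)
  have UNAK: "(\<Union>n. AK n) = A"
  proof -
    have "\<exists>n. p \<in> K n \<times> K n" for p :: "'a \<times> 'a"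
    proof -
      obtain n where "max (norm (fst p)) (norm (snd p)) < real n" using reals_Archimedean2 by blast
      then show ?thesis by (intro exI[of _ n]) (auto simp: K_def mem_Times_iff)
    qed
    then show ?thesis by (force simp: AK_def)
  qed
  have inc: "incseq (\<lambda>n. void_pairs (AK n) D \<omega>)" for \<omega>
    using incAK by (auto simp: void_pairs_def ordered_pairs_def monotone_def)
  have UN: "void_pairs A D \<omega> = (\<Union>n. void_pairs (AK n) D \<omega>)" for \<omega>
    using UNAK by (auto simp: void_pairs_def ordered_pairs_def)
  have eq: "num (void_pairs A D \<omega>) = (SUP n. num (void_pairs (AK n) D \<omega>))" for \<omega>
    unfolding UN using inc by (intro SUP_emeasure_incseq[symmetric]) auto
  have "(\<integral>\<^sup>+\<omega>. num (void_pairs A D \<omega>) \<partial>M) = (SUP n. \<integral>\<^sup>+\<omega>. num (void_pairs (AK n) D \<omega>) \<partial>M)"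
    unfolding eq using b inc
    by (intro nn_integral_monotone_convergence_SUP)
      (auto intro!: incseq_SucI le_funI emeasure_mono dest: incseq_SucD)
  also have "\<dots> = (SUP n. emeasure (density lborel ?w) (AK n))"
    using b mw sAK by (simp add: emeasure_density)
  also have "\<dots> = emeasure (density lborel ?w) A"
    unfolding UNAK[symmetric] using sAK incAK by (intro SUP_emeasure_incseq) auto
  also have "\<dots> = (\<integral>\<^sup>+p. ?w p * indicator A p \<partial>lborel)"
    using mw A by (simp add: emeasure_density)
  finally have int: "(\<integral>\<^sup>+\<omega>. num (void_pairs A D \<omega>) \<partial>M) = (\<integral>\<^sup>+p. ?w p * indicator A p \<partial>lborel)" .
  have "(\<lambda>\<omega>. num (void_pairs A D \<omega>)) \<in> borel_measurable M"
    unfolding eq using b by (intro borel_measurable_SUP) auto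
  with int show ?thesis by blast
qed

end

text \<open>A ball without the two points is open, hence the union of those balls of a countable
  family that fit inside it and avoid both points. For each member of the family, fitting is a Borel
  condition on \<open>p\<close>. The two points form a null set, so the weight involves the full
  ball.\<close>

lemma void_pairs_ball:
  assumes A: "A \<in> sets borel" and int: "0 \<le> intensity"
    and c: "c \<in> borel_measurable borel" and r: "r \<in> borel_measurable borel"
  defines "D \<equiv> \<lambda>p. ball (c p) (r p) - {fst p, snd p}"
  shows "(\<lambda>\<omega>. num (void_pairs A D \<omega>)) \<in> borel_measurable M"
    and "(\<integral>\<^sup>+\<omega>. num (void_pairs A D \<omega>) \<partial>M) =
    (\<integral>\<^sup>+p. ennreal (intensity\<^sup>2 * exp (- (intensity * measure lborel (ball (c p) (r p))))) * indicator A p \<partial>lborel)"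
proof -
  obtain b :: "nat \<Rightarrow> 'a" and q :: "nat \<Rightarrow> real" where bq: "\<And>k. 0 < q k"
      "\<And>w e. 0 < e \<Longrightarrow> \<exists>k. w \<in> ball (b k) (q k) \<and> 2 * q k \<le> e"
    using countable_balls_cover by blast
  define U where "U k = ball (b k) (q k)" for k
  define R where "R k = {p. dist (b k) (c p) + q k \<le> r p \<and> fst p \<notin> U k \<and> snd p \<notin> U k}" for k
  have D: "D p = (\<Union>k\<in>{k. p \<in> R k}. U k)" for p
  proof (intro set_eqI iffI)
    fix w assume w: "w \<in> D p"
    \<comment> \<open>This is the least of the distance from \<open>w\<close> to the removed points
      and its margin to the boundary: any ball of the family containing \<open>w\<close> with
      diameter parameter \<open>2 * q k\<close> at most \<open>e\<close> fits into
      \<open>D p\<close>.\<close>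
    define e where "e = min (r p - dist w (c p)) (min (dist w (fst p)) (dist w (snd p)))"
    have "0 < e" using w by (auto simp: e_def D_def dist_commute)
    then obtain k where k: "w \<in> ball (b k) (q k)" "2 * q k \<le> e" using bq(2) by blast
    have "dist (b k) w < q k" using k(1) by simp
    moreover have "dist (b k) (c p) \<le> dist (b k) w + dist w (c p)" by (rule dist_triangle)
    moreover have "dist w (fst p) \<le> dist (b k) w + dist (b k) (fst p)"
      "dist w (snd p) \<le> dist (b k) w + dist (b k) (snd p)"
      by (metis dist_commute dist_triangle)+
    ultimately have "p \<in> R k" using k(2) by (auto simp: R_def U_def e_def)
    then show "w \<in> (\<Union>k\<in>{k. p \<in> R k}. U k)" using k(1) by (auto simp: U_def)
  next
    fix w assume "w \<in> (\<Union>k\<in>{k. p \<in> R k}. U k)"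
    then obtain k where k: "p \<in> R k" "w \<in> U k" by blast
    have "dist (c p) w \<le> dist (b k) (c p) + dist (b k) w" by (metis dist_commute dist_triangle)
    then show "w \<in> D p" using k by (auto simp: R_def U_def D_def)
  qed
  note [measurable] = c r
  have bD: "bounded (D p)" for p
    by (rule bounded_subset[OF bounded_ball]) (auto simp: D_def)
  have R_eq: "R k = {p. dist (b k) (c p) + q k \<le> r p} \<inter> {p. q k \<le> dist (b k) (fst p)} \<inter>
      {p. q k \<le> dist (b k) (snd p)}" for k
    by (auto simp: R_def U_def)
  have "{p. dist (b k) (c p) + q k \<le> r p} \<in> sets borel"
    "{p::'a \<times> 'a. q k \<le> dist (b k) (fst p)} \<in> sets borel"
    "{p::'a \<times> 'a. q k \<le> dist (b k) (snd p)} \<in> sets borel" for k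
    by measurable (intro borel_closed closed_Collect_le continuous_intros)+
  then have "R k \<in> sets borel" for k
    unfolding R_eq by (intro sets.Int)
  then have *: "(\<lambda>\<omega>. num (void_pairs A D \<omega>)) \<in> borel_measurable M \<and>
    (\<integral>\<^sup>+\<omega>. num (void_pairs A D \<omega>) \<partial>M) =
    (\<integral>\<^sup>+p. ennreal (intensity\<^sup>2 * exp (- (intensity * measure lborel (D p)))) * indicator A p \<partial>lborel)"
    by (intro void_pairs_UN[where U=U and R=R, OF _ _ _ _ int A D bD]) (auto simp: U_def R_def)
  then show "(\<lambda>\<omega>. num (void_pairs A D \<omega>)) \<in> borel_measurable M" by blast
  have "measure lborel (D p) = measure lborel (ball (c p) (r p))" for p
    unfolding D_def by (intro measure_Diff_null_set) (auto intro!: finite_imp_null_set_lborel)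
  with * show "(\<integral>\<^sup>+\<omega>. num (void_pairs A D \<omega>) \<partial>M) =
    (\<integral>\<^sup>+p. ennreal (intensity\<^sup>2 * exp (- (intensity * measure lborel (ball (c p) (r p))))) * indicator A p \<partial>lborel)"
    by simp
qed

end

subsection \<open>Chord coordinates\<close>

lemma nn_integral_lborel_swap:
  fixes f :: "real \<Rightarrow> real \<Rightarrow> ennreal"
  assumes "case_prod f \<in> borel_measurable (borel \<Otimes>\<^sub>M borel)"
  shows "(\<integral>\<^sup>+x. \<integral>\<^sup>+y. f x y \<partial>lborel \<partial>lborel) = (\<integral>\<^sup>+y. \<integral>\<^sup>+x. f x y \<partial>lborel \<partial>lborel)"
proof -
  have "case_prod f \<in> borel_measurable (lborel \<Otimes>\<^sub>M lborel)"
    using assms measurable_cong_sets[OF sets_pair_measure_cong[OF sets_lborel sets_lborel] refl] by blast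
  then show ?thesis by (rule lborel_pair.Fubini'[symmetric])
qed

lemma nn_integral_lborel_translate:
  fixes f :: "real \<Rightarrow> ennreal"
  assumes "f \<in> borel_measurable borel"
  shows "(\<integral>\<^sup>+x. f x \<partial>lborel) = (\<integral>\<^sup>+x. f (t + x) \<partial>lborel)"
  using nn_integral_real_affine[OF assms, of 1 t] by simp

lemma nn_integral_lborel_prod:
  fixes f :: "'a::euclidean_space \<times> 'b::euclidean_space \<Rightarrow> ennreal"
  assumes "f \<in> borel_measurable (borel \<Otimes>\<^sub>M borel)"
  shows "(\<integral>\<^sup>+p. f p \<partial>lborel) = (\<integral>\<^sup>+x. \<integral>\<^sup>+y. f (x, y) \<partial>lborel \<partial>lborel)"
  using assms by (subst lborel.nn_integral_fst) (simp_all add: lborel_prod borel_prod)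

lemma nn_integral_pairs_of_points:
  fixes f :: "point \<times> point \<Rightarrow> ennreal"
  assumes f: "f \<in> borel_measurable borel"
  shows "(\<integral>\<^sup>+p. f p \<partial>lborel) =
    (\<integral>\<^sup>+x1. \<integral>\<^sup>+x2. \<integral>\<^sup>+y1. \<integral>\<^sup>+y2. f ((x1, x2), (y1, y2)) \<partial>lborel \<partial>lborel \<partial>lborel \<partial>lborel)"
proof -
  have m [measurable]: "f \<in> borel_measurable ((borel \<Otimes>\<^sub>M borel) \<Otimes>\<^sub>M (borel \<Otimes>\<^sub>M borel))"
    using f by (simp add: borel_prod)
  have sect: "(\<lambda>y. f (x, y)) \<in> borel_measurable (borel \<Otimes>\<^sub>M borel)" for x
    by (rule measurable_Pair2[OF m]) (simp add: space_pair_measure)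
  have "(\<integral>\<^sup>+p. f p \<partial>lborel) = (\<integral>\<^sup>+x. \<integral>\<^sup>+y. f (x, y) \<partial>lborel \<partial>lborel)"
    using f by (intro nn_integral_lborel_prod) (simp add: borel_prod)
  also have "\<dots> = (\<integral>\<^sup>+x. \<integral>\<^sup>+y1. \<integral>\<^sup>+y2. f (x, (y1, y2)) \<partial>lborel \<partial>lborel \<partial>lborel)"
    by (intro nn_integral_cong nn_integral_lborel_prod sect)
  also have "\<dots> = (\<integral>\<^sup>+x1. \<integral>\<^sup>+x2. \<integral>\<^sup>+y1. \<integral>\<^sup>+y2. f ((x1, x2), (y1, y2)) \<partial>lborel \<partial>lborel \<partial>lborel \<partial>lborel)"
    by (rule nn_integral_lborel_prod) measurable
  finally show ?thesis .
qed

text \<open>Here \<open>d\<close> is the horizontal extent of the chord, \<open>u\<close> its slope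
  and \<open>(z - u m, m)\<close> its midpoint. The perpendicular bisector has direction
  \<open>(-u, 1)\<close> and therefore meets the axis at \<open>z\<close>. The change of variables
  is made one variable at a time; all substitutions are translations except that of the slope, whose
  scaling gives the Jacobian \<open>d\<close>.\<close>

lemma nn_integral_chord_coordinates:
  fixes f :: "point \<times> point \<Rightarrow> ennreal"
  assumes f: "f \<in> borel_measurable borel" and zero: "\<And>x y. fst y \<le> fst x \<Longrightarrow> f (x, y) = 0"
  shows "(\<integral>\<^sup>+p. f p \<partial>lborel) =
    (\<integral>\<^sup>+d. \<integral>\<^sup>+u. \<integral>\<^sup>+m. \<integral>\<^sup>+z. ennreal d *
      f ((z - d / 2 - u * m, m - u * d / 2), (z + d / 2 - u * m, m + u * d / 2))
      \<partial>lborel \<partial>lborel \<partial>lborel \<partial>lborel)"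
proof -
  have [measurable]: "f \<in> borel_measurable ((borel \<Otimes>\<^sub>M borel) \<Otimes>\<^sub>M (borel \<Otimes>\<^sub>M borel))"
    using f by (simp add: borel_prod)
  let ?k = "\<lambda>d u x2 x1. ennreal d * f ((x1, x2), (x1 + d, x2 + d * u))"
  \<comment> \<open>The slope is introduced by \<open>y2 = x2 + d * u\<close>. For
    \<open>d \<le> 0\<close> both sides vanish by the assumption on \<open>f\<close>.\<close>
  have y2: "(\<integral>\<^sup>+y2. f ((x1, x2), (x1 + d, y2)) \<partial>lborel) = (\<integral>\<^sup>+u. ?k d u x2 x1 \<partial>lborel)" for x1 x2 d
  proof (cases "0 < d")
    case True
    then show ?thesis
      by (subst nn_integral_real_affine[where c=d and t=x2]) (simp_all add: nn_integral_cmult)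
  next
    case False
    then show ?thesis by (simp add: zero)
  qed
  have x1x2: "(\<integral>\<^sup>+x2. \<integral>\<^sup>+x1. ?k d u x2 x1 \<partial>lborel \<partial>lborel) =
      (\<integral>\<^sup>+m. \<integral>\<^sup>+z. ennreal d *
        f ((z - d / 2 - u * m, m - u * d / 2), (z + d / 2 - u * m, m + u * d / 2)) \<partial>lborel \<partial>lborel)" for d u
  proof -
    have "(\<integral>\<^sup>+x2. \<integral>\<^sup>+x1. ?k d u x2 x1 \<partial>lborel \<partial>lborel) =
        (\<integral>\<^sup>+m. \<integral>\<^sup>+x1. ?k d u (- (u * d / 2) + m) x1 \<partial>lborel \<partial>lborel)"
      by (rule nn_integral_lborel_translate) measurable
    also have "\<dots> = (\<integral>\<^sup>+m. \<integral>\<^sup>+z. ?k d u (- (u * d / 2) + m) ((- (d / 2) - u * m) + z) \<partial>lborel \<partial>lborel)"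
      by (intro nn_integral_cong nn_integral_lborel_translate) measurable
    finally show ?thesis by (simp add: algebra_simps)
  qed
  have "(\<integral>\<^sup>+p. f p \<partial>lborel) =
      (\<integral>\<^sup>+x1. \<integral>\<^sup>+x2. \<integral>\<^sup>+y1. \<integral>\<^sup>+y2. f ((x1, x2), (y1, y2)) \<partial>lborel \<partial>lborel \<partial>lborel \<partial>lborel)"
    using f by (rule nn_integral_pairs_of_points)
  also have "\<dots> = (\<integral>\<^sup>+x1. \<integral>\<^sup>+x2. \<integral>\<^sup>+d. \<integral>\<^sup>+y2. f ((x1, x2), (x1 + d, y2)) \<partial>lborel \<partial>lborel \<partial>lborel \<partial>lborel)"
    by (intro nn_integral_cong nn_integral_lborel_translate) measurable
  also have "\<dots> = (\<integral>\<^sup>+x1. \<integral>\<^sup>+x2. \<integral>\<^sup>+d. \<integral>\<^sup>+u. ?k d u x2 x1 \<partial>lborel \<partial>lborel \<partial>lborel \<partial>lborel)"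
    by (simp only: y2)
  \<comment> \<open>The integrals over \<open>d\<close> and \<open>u\<close> are moved outside,
    because the remaining translations of \<open>x2\<close> and \<open>x1\<close> depend on
    them.\<close>
  also have "\<dots> = (\<integral>\<^sup>+x1. \<integral>\<^sup>+d. \<integral>\<^sup>+x2. \<integral>\<^sup>+u. ?k d u x2 x1 \<partial>lborel \<partial>lborel \<partial>lborel \<partial>lborel)"
    by (intro nn_integral_cong nn_integral_lborel_swap) measurable
  also have "\<dots> = (\<integral>\<^sup>+d. \<integral>\<^sup>+x1. \<integral>\<^sup>+x2. \<integral>\<^sup>+u. ?k d u x2 x1 \<partial>lborel \<partial>lborel \<partial>lborel \<partial>lborel)"
    by (intro nn_integral_lborel_swap) measurable
  also have "\<dots> = (\<integral>\<^sup>+d. \<integral>\<^sup>+x1. \<integral>\<^sup>+u. \<integral>\<^sup>+x2. ?k d u x2 x1 \<partial>lborel \<partial>lborel \<partial>lborel \<partial>lborel)"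
    by (intro nn_integral_cong nn_integral_lborel_swap) measurable
  also have "\<dots> = (\<integral>\<^sup>+d. \<integral>\<^sup>+u. \<integral>\<^sup>+x1. \<integral>\<^sup>+x2. ?k d u x2 x1 \<partial>lborel \<partial>lborel \<partial>lborel \<partial>lborel)"
    by (intro nn_integral_cong nn_integral_lborel_swap) measurable
  also have "\<dots> = (\<integral>\<^sup>+d. \<integral>\<^sup>+u. \<integral>\<^sup>+x2. \<integral>\<^sup>+x1. ?k d u x2 x1 \<partial>lborel \<partial>lborel \<partial>lborel \<partial>lborel)"
    by (intro nn_integral_cong nn_integral_lborel_swap) measurable
  finally show ?thesis by (simp only: x1x2)
qed

section \<open>The one-dimensional integrals for the chord width, the slope and the angle\<close>

lemma nn_integral_gaussian_second_moment:
  assumes k: "0 < k"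
  shows "(\<integral>\<^sup>+d. ennreal (d\<^sup>2 * exp (- (k * d\<^sup>2))) * indicator {0..} d \<partial>lborel) =
    ennreal (sqrt pi / (4 * (k * sqrt k)))"
proof -
  let ?f = "\<lambda>x::real. indicator {0..} x *\<^sub>R (exp (- x\<^sup>2) * x ^ (2 * 1))"
  have "has_bochner_integral lborel ?f (sqrt pi / 4)"
    using gaussian_moment_even_pos[of 1] by simp
  then have "(\<integral>\<^sup>+x. ennreal (?f x) \<partial>lborel) = ennreal (sqrt pi / 4)"
    by (subst nn_integral_eq_integral) (auto simp: has_bochner_integral_iff)
  then have "ennreal (sqrt pi / 4) = (\<integral>\<^sup>+x. ennreal (?f x) \<partial>lborel)" ..
  also have "\<dots> = ennreal (sqrt k) * (\<integral>\<^sup>+d. ennreal (?f (0 + sqrt k * d)) \<partial>lborel)"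
    using k by (subst nn_integral_real_affine[where c="sqrt k" and t=0]) auto
  also have "(\<integral>\<^sup>+d. ennreal (?f (0 + sqrt k * d)) \<partial>lborel) =
      (\<integral>\<^sup>+d. ennreal k * (ennreal (d\<^sup>2 * exp (- (k * d\<^sup>2))) * indicator {0..} d) \<partial>lborel)"
    using k by (intro nn_integral_cong)
      (auto simp: power_mult_distrib zero_le_mult_iff ennreal_mult[symmetric] mult_ac split: split_indicator)
  also have "\<dots> = ennreal k * (\<integral>\<^sup>+d. ennreal (d\<^sup>2 * exp (- (k * d\<^sup>2))) * indicator {0..} d \<partial>lborel)"
    by (rule nn_integral_cmult) measurable
  finally have *: "ennreal (sqrt pi / 4) = ennreal (k * sqrt k) * (\<integral>\<^sup>+d. ennreal (d\<^sup>2 * exp (- (k * d\<^sup>2))) * indicator {0..} d \<partial>lborel)"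
    using k by (simp add: ennreal_mult mult_ac)
  have "ennreal (k * sqrt k) * ennreal (sqrt pi / (4 * (k * sqrt k))) = ennreal (sqrt pi / 4)"
    using k by (subst ennreal_mult[symmetric]) (auto simp: field_simps)
  with * have "ennreal (k * sqrt k) * (\<integral>\<^sup>+d. ennreal (d\<^sup>2 * exp (- (k * d\<^sup>2))) * indicator {0..} d \<partial>lborel) =
      ennreal (k * sqrt k) * ennreal (sqrt pi / (4 * (k * sqrt k)))" by simp
  then show ?thesis
    using k by (subst (asm) ennreal_mult_cancel_left) (auto simp: ennreal_eq_0_iff mult_le_0_iff)
qed

text \<open>The exponent -3/2 of \<open>1 + u\<^sup>2\<close> is that of \<open>k\<close> in the
  Gaussian moment, whose \<open>k\<close> will be proportional to
  \<open>(1 + c\<^sup>2) * (1 + u\<^sup>2)\<close>. The same weight thus arises for the slope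
  \<open>u\<close> and for the angle parameter \<open>c\<close>.\<close>

definition slope_weight :: "real \<Rightarrow> real" where
  "slope_weight u = 1 / ((1 + u\<^sup>2) * sqrt (1 + u\<^sup>2))"

lemma slope_weight_nonneg: "0 \<le> slope_weight u"
  by (simp add: slope_weight_def)

lemma one_plus_square_pos: "0 < 1 + u\<^sup>2" for u :: real
  by (simp add: add_pos_nonneg)

lemma measurable_slope_weight [measurable]: "slope_weight \<in> borel_measurable borel"
  unfolding slope_weight_def[abs_def] by measurable

text \<open>The antiderivative \<open>u / sqrt (1 + u\<^sup>2)\<close>, the sine of
  \<open>arctan u\<close>, tends to 1. By symmetry both half lines contribute 1.\<close>

lemma nn_integral_slope_weight: "(\<integral>\<^sup>+u. ennreal (slope_weight u) \<partial>lborel) = 2"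
proof -
  have deriv: "((\<lambda>u. u / sqrt (1 + u\<^sup>2)) has_real_derivative slope_weight u) (at u)" for u
  proof -
    have s: "sqrt (1 + u\<^sup>2) > 0" "sqrt (1 + u\<^sup>2) ^ 2 = 1 + u\<^sup>2"
      using one_plus_square_pos[of u] by simp_all
    show ?thesis
      using s one_plus_square_pos[of u]
      by (auto intro!: derivative_eq_intros simp: slope_weight_def field_simps power2_eq_square)
  qed
  have lim: "((\<lambda>u::real. u / sqrt (1 + u\<^sup>2)) \<longlongrightarrow> 1) at_top"
    by real_asymp
  have half: "(\<integral>\<^sup>+u. ennreal (slope_weight u) * indicator {0..} u \<partial>lborel) = 1"
    using nn_integral_FTC_atLeast[OF measurable_slope_weight deriv slope_weight_nonneg lim, of 0] by simp
  have even: "slope_weight (- u) = slope_weight u" for u by (simp add: slope_weight_def)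
  have "(\<integral>\<^sup>+u. ennreal (slope_weight u) * indicator {..0} u \<partial>lborel) =
      (\<integral>\<^sup>+u. ennreal (slope_weight (0 + - 1 * u)) * indicator {..0} (0 + - 1 * u) \<partial>lborel)"
    by (subst nn_integral_real_affine[where c="-1" and t=0]) simp_all
  also have "\<dots> = (\<integral>\<^sup>+u. ennreal (slope_weight u) * indicator {0..} u \<partial>lborel)"
    by (intro nn_integral_cong) (auto simp: even split: split_indicator)
  finally have other: "(\<integral>\<^sup>+u. ennreal (slope_weight u) * indicator {..0} u \<partial>lborel) = 1"
    using half by simp
  have "AE u in lborel. u \<noteq> (0::real)" by (rule AE_lborel_singleton)
  then have "(\<integral>\<^sup>+u. ennreal (slope_weight u) \<partial>lborel) =
      (\<integral>\<^sup>+u. ennreal (slope_weight u) * indicator {0..} u + ennreal (slope_weight u) * indicator {..0} u \<partial>lborel)"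
    by (intro nn_integral_cong_AE) (auto split: split_indicator)
  also have "\<dots> = 1 + 1"
    by (subst nn_integral_add) (simp_all add: half other)
  finally show ?thesis by simp
qed

text \<open>With \<open>c\<close> the cotangent of \<open>t / 2\<close>, \<open>dt\<close> has
  absolute value \<open>2 / (1 + c\<^sup>2) dc\<close> and
  \<open>sin (t / 2) = 1 / sqrt (1 + c\<^sup>2)\<close>, so one half of
  \<open>sin (t / 2) dt\<close> is exactly the slope weight.\<close>

lemma nn_integral_arctan_substitution:
  assumes B: "B \<in> sets borel" "B \<subseteq> {0<..<2 * pi}"
  shows "(\<integral>\<^sup>+c. ennreal (slope_weight c) * indicator B (pi - 2 * arctan c) \<partial>lborel) =
    (\<integral>\<^sup>+t. ennreal (sin (t / 2) / 2) * indicator B t \<partial>lborel)"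
proof -
  note [measurable] = B(1)
  \<comment> \<open>The angle decreases in \<open>c\<close>; passing to \<open>s = - t\<close> makes
    the substitution \<open>g\<close> increasing. It is applied on the compact intervals from
    \<open>-n\<close> to \<open>n\<close>, which exhaust the line.\<close>
  define f where "f s = indicator B (- s) * (sin (- s / 2) / 2)" for s :: real
  define g where "g c = 2 * arctan c - pi" for c
  have [measurable]: "f \<in> borel_measurable borel" "g \<in> borel_measurable borel"
    unfolding f_def[abs_def] g_def[abs_def] by measurable
  let ?I = "\<lambda>n::nat. {- real n .. real n}"
  have g_deriv: "(g has_real_derivative 2 / (1 + x\<^sup>2)) (at x)" for x
    unfolding g_def by (auto intro!: derivative_eq_intros simp: divide_inverse)
  have contg: "continuous_on X (\<lambda>x::real. 2 / (1 + x\<^sup>2))" for X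
    using one_plus_square_pos by (intro continuous_intros) (metis less_irrefl)
  have fg: "f (g c) * (2 / (1 + c\<^sup>2)) = slope_weight c * indicator B (pi - 2 * arctan c)" for c
  proof -
    have "sin (- g c / 2) = cos (arctan c)"
      by (simp add: g_def diff_divide_distrib sin_diff)
    then show ?thesis
      by (simp add: f_def g_def cos_arctan slope_weight_def)
  qed
  have step: "(\<integral>\<^sup>+s. ennreal (f s) * indicator {g (- real n)..g (real n)} s \<partial>lborel) =
      (\<integral>\<^sup>+c. ennreal (slope_weight c) * indicator B (pi - 2 * arctan c) * indicator (?I n) c \<partial>lborel)" for n
  proof -
    have "(\<integral>\<^sup>+s. ennreal (f s * indicator {g (- real n)..g (real n)} s) \<partial>lborel) =
        (\<integral>\<^sup>+c. ennreal (f (g c) * (2 / (1 + c\<^sup>2)) * indicator (?I n) c) \<partial>lborel)"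
      using g_deriv contg one_plus_square_pos
      by (intro nn_integral_substitution) (auto simp: set_borel_measurable_def less_imp_le)
    then show ?thesis
      unfolding fg by (simp add: ennreal_mult' ennreal_indicator slope_weight_nonneg ennreal_mult'')
  qed
  have incI: "incseq ?I" by (intro monoI) auto
  have UNI: "(\<Union>n. ?I n) = UNIV"
  proof -
    have "\<exists>n. x \<in> ?I n" for x
      using real_arch_simple[of "\<bar>x\<bar>"] by (auto simp: abs_le_iff minus_le_iff)
    then show ?thesis by blast
  qed
  have gmono: "x \<le> y \<Longrightarrow> g x \<le> g y" for x y by (simp add: g_def arctan_monotone')
  have gI: "incseq (\<lambda>n. {g (- real n)..g (real n)})"
    by (intro monoI) (auto intro: gmono order_trans)
  have UNg: "f s \<noteq> 0 \<Longrightarrow> s \<in> (\<Union>n. {g (- real n)..g (real n)})" for s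
  proof -
    assume "f s \<noteq> 0"
    then have s: "- 2 * pi < s" "s < 0" using B(2) by (auto simp: f_def indicator_def split: if_splits)
    define c where "c = tan ((s + pi) / 2)"
    have "arctan c = (s + pi) / 2" unfolding c_def using s by (intro arctan_tan) (auto simp: field_simps)
    then have "s = g c" by (simp add: g_def)
    moreover obtain n where "c \<in> ?I n" using UNI by blast
    ultimately show ?thesis by (auto intro!: gmono)
  qed
  have "(\<integral>\<^sup>+t. ennreal (sin (t / 2) / 2) * indicator B t \<partial>lborel) =
     (\<integral>\<^sup>+s. ennreal (sin ((0 + - 1 * s) / 2) / 2) * indicator B (0 + - 1 * s) \<partial>lborel)"
    by (subst nn_integral_real_affine[where c="-1" and t=0]) simp_all
  also have "\<dots> = (\<integral>\<^sup>+s. ennreal (f s) * indicator (\<Union>n. {g (- real n)..g (real n)}) s \<partial>lborel)"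
    using UNg by (intro nn_integral_cong) (force simp: f_def split: split_indicator)
  also have "\<dots> = emeasure (density lborel f) (\<Union>n. {g (- real n)..g (real n)})"
    by (subst emeasure_density) auto
  also have "\<dots> = (SUP n. emeasure (density lborel f) {g (- real n)..g (real n)})"
    using gI by (intro SUP_emeasure_incseq[symmetric]) auto
  also have "\<dots> = (SUP n. emeasure (density lborel (\<lambda>c. ennreal (slope_weight c) * indicator B (pi - 2 * arctan c))) (?I n))"
    by (simp add: emeasure_density step)
  also have "\<dots> = emeasure (density lborel (\<lambda>c. ennreal (slope_weight c) * indicator B (pi - 2 * arctan c))) UNIV"
    unfolding UNI[symmetric] using incI by (intro SUP_emeasure_incseq) auto
  also have "\<dots> = (\<integral>\<^sup>+c. ennreal (slope_weight c) * indicator B (pi - 2 * arctan c) \<partial>lborel)"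
    by (subst emeasure_density) auto
  finally show ?thesis ..
qed

subsection \<open>Integration over pairs of points\<close>

text \<open>The abscissa at which the perpendicular bisector meets the axis. For equal first
  coordinates the quotient takes the default 0; such pairs are excluded wherever the geometric
  meaning matters.\<close>

definition bisector_crossing :: "point \<times> point \<Rightarrow> real" where
  "bisector_crossing p = (fst (fst p) + fst (snd p)) / 2 +
     ((snd (snd p))\<^sup>2 - (snd (fst p))\<^sup>2) / (2 * (fst (snd p) - fst (fst p)))"

definition crossing_radius :: "point \<times> point \<Rightarrow> real" where
  "crossing_radius p = dist (fst p) (bisector_crossing p, 0)"

text \<open>In chord coordinates the quotient is \<open>2 * m / d\<close>, the cotangent of half the
  angle. A midpoint above the axis gives an angle below \<open>pi\<close>, a midpoint below the axis
  one above \<open>pi\<close>.\<close>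

definition pair_angle :: "point \<times> point \<Rightarrow> real" where
  "pair_angle p = pi - 2 * arctan ((snd (fst p) + snd (snd p)) / (fst (snd p) - fst (fst p)))"

definition crossing_pairs :: "real set \<Rightarrow> (point \<times> point) set" where
  "crossing_pairs B = {p. fst (fst p) < fst (snd p) \<and> bisector_crossing p \<in> {0..1} \<and> pair_angle p \<in> B}"

lemma measurable_coordinates [measurable]:
  "(\<lambda>p :: point \<times> point. fst (fst p)) \<in> borel_measurable borel"
  "(\<lambda>p :: point \<times> point. snd (fst p)) \<in> borel_measurable borel"
  "(\<lambda>p :: point \<times> point. fst (snd p)) \<in> borel_measurable borel"
  "(\<lambda>p :: point \<times> point. snd (snd p)) \<in> borel_measurable borel"
  by (intro borel_measurable_continuous_onI continuous_intros)+

lemma measurable_bisector_crossing [measurable]: "bisector_crossing \<in> borel_measurable borel"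
  unfolding bisector_crossing_def[abs_def] by measurable

lemma measurable_pair_angle [measurable]: "pair_angle \<in> borel_measurable borel"
  unfolding pair_angle_def[abs_def] by measurable

lemma crossing_radius_eq:
  "crossing_radius p = sqrt ((fst (fst p) - bisector_crossing p)\<^sup>2 + (snd (fst p))\<^sup>2)"
  by (cases "fst p") (simp add: crossing_radius_def dist_prod_def dist_real_def)

lemma measurable_crossing_radius [measurable]: "crossing_radius \<in> borel_measurable borel"
  unfolding crossing_radius_eq[abs_def] by measurable

lemma sets_crossing_pairs:
  assumes [measurable]: "B \<in> sets borel"
  shows "crossing_pairs B \<in> sets borel"
  unfolding crossing_pairs_def by measurable

text \<open>The radius is Pythagoras: from \<open>(z, 0)\<close> the midpoint is at distance
  \<open>\<bar>m\<bar> * sqrt (1 + u\<^sup>2)\<close>, and half the chord, orthogonal to that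
  segment, has length \<open>d / 2 * sqrt (1 + u\<^sup>2)\<close>.\<close>

lemma
  fixes z d u m :: real
  assumes d: "0 < d"
  defines "p \<equiv> ((z - d / 2 - u * m, m - u * d / 2), (z + d / 2 - u * m, m + u * d / 2))"
  shows bisector_crossing_chord: "bisector_crossing p = z"
    and crossing_radius_chord: "(crossing_radius p)\<^sup>2 = (d\<^sup>2 / 4 + m\<^sup>2) * (1 + u\<^sup>2)"
    and pair_angle_chord: "pair_angle p = pi - 2 * arctan (2 * m / d)"
proof -
  show *: "bisector_crossing p = z"
    using d by (simp add: bisector_crossing_def p_def field_simps power2_eq_square)
  show "(crossing_radius p)\<^sup>2 = (d\<^sup>2 / 4 + m\<^sup>2) * (1 + u\<^sup>2)"
  proof -
    have "(crossing_radius p)\<^sup>2 = (fst (fst p) - z)\<^sup>2 + (snd (fst p))\<^sup>2"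
      by (simp add: crossing_radius_eq *)
    then show ?thesis by (simp add: p_def power2_eq_square field_simps)
  qed
  show "pair_angle p = pi - 2 * arctan (2 * m / d)"
    by (simp add: pair_angle_def p_def)
qed

text \<open>For fixed \<open>c\<close> and \<open>u\<close> the Gaussian moment with
  \<open>k = l * pi / 4 * (1 + c\<^sup>2) * (1 + u\<^sup>2)\<close> yields
  \<open>sqrt l / pi\<close> times two slope weights. The slope contributes 2, which cancels the one
  half from the angle substitution.\<close>

lemma nn_integral_crossing_pairs:
  assumes l: "0 < l" and B: "B \<in> sets borel" "B \<subseteq> {0<..<2 * pi}"
  shows "(\<integral>\<^sup>+p. ennreal (l\<^sup>2 * exp (- (l * (pi * (crossing_radius p)\<^sup>2)))) * indicator (crossing_pairs B) p \<partial>lborel) =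
    ennreal (sqrt l / pi) * (\<integral>\<^sup>+t. ennreal (sin (t / 2)) * indicator B t \<partial>lborel)"
proof -
  note [measurable] = B(1) sets_crossing_pairs[OF B(1)]
  let ?f = "\<lambda>p. ennreal (l\<^sup>2 * exp (- (l * (pi * (crossing_radius p)\<^sup>2)))) * indicator (crossing_pairs B) p"
  let ?b = "\<lambda>c. indicator B (pi - 2 * arctan c) :: ennreal"
  let ?E = "\<lambda>d u m. ennreal d * ennreal (l\<^sup>2 * exp (- (l * (pi * ((d\<^sup>2 / 4 + m\<^sup>2) * (1 + u\<^sup>2))))))"
  let ?k = "\<lambda>u c. l * pi / 4 * ((1 + c\<^sup>2) * (1 + u\<^sup>2))"
  let ?g = "\<lambda>d u c. ennreal (l\<^sup>2 / 2) * (ennreal (d\<^sup>2 * exp (- (?k u c * d\<^sup>2))) * indicator {0..} d) * ?b c"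
  \<comment> \<open>By translation along the axis, \<open>z\<close> enters only through the
    condition \<open>0 \<le> z \<le> 1\<close>, which has length 1.\<close>
  have z: "(\<integral>\<^sup>+z. ennreal d * ?f ((z - d / 2 - u * m, m - u * d / 2), (z + d / 2 - u * m, m + u * d / 2)) \<partial>lborel) =
      ?E d u m * ?b (2 * m / d)" for d u m
  proof (cases "0 < d")
    case True
    have "(\<integral>\<^sup>+z. ennreal d * ?f ((z - d / 2 - u * m, m - u * d / 2), (z + d / 2 - u * m, m + u * d / 2)) \<partial>lborel) =
        (\<integral>\<^sup>+z. ?E d u m * ?b (2 * m / d) * indicator {0..1::real} z \<partial>lborel)"
      using True
      by (intro nn_integral_cong)
        (auto simp: crossing_radius_chord crossing_pairs_def bisector_crossing_chord pair_angle_chord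
          indicator_def mult.assoc)
    then show ?thesis by (simp add: nn_integral_cmult_indicator)
  next
    case False
    then show ?thesis by (simp add: ennreal_neg)
  qed
  \<comment> \<open>Setting \<open>m = d / 2 * c\<close> makes the angle a function of
    \<open>c\<close> alone. Its factor \<open>d / 2\<close> and the Jacobian \<open>d\<close>
    produce the \<open>d\<^sup>2\<close> of the second moment and the constant
    \<open>l\<^sup>2 / 2\<close>.\<close>
  have m: "(\<integral>\<^sup>+m. ?E d u m * ?b (2 * m / d) \<partial>lborel) = (\<integral>\<^sup>+c. ?g d u c \<partial>lborel)" for d u
  proof (cases "0 < d")
    case True
    have "(\<integral>\<^sup>+m. ?E d u m * ?b (2 * m / d) \<partial>lborel) =
        ennreal (d / 2) * (\<integral>\<^sup>+c. ?E d u (0 + d / 2 * c) * ?b (2 * (0 + d / 2 * c) / d) \<partial>lborel)"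
      using True by (subst nn_integral_real_affine[where c="d / 2" and t=0]) auto
    also have "\<dots> = (\<integral>\<^sup>+c. ennreal (d / 2) * (?E d u (0 + d / 2 * c) * ?b (2 * (0 + d / 2 * c) / d)) \<partial>lborel)"
      by (rule nn_integral_cmult[symmetric]) measurable
    also have "\<dots> = (\<integral>\<^sup>+c. ?g d u c \<partial>lborel)"
    proof (intro nn_integral_cong)
      fix c
      have e: "l * (pi * ((d\<^sup>2 / 4 + (0 + d / 2 * c)\<^sup>2) * (1 + u\<^sup>2))) = ?k u c * d\<^sup>2"
        by (simp add: field_simps power2_eq_square)
      have "ennreal (d / 2) * (ennreal d * ennreal (l\<^sup>2 * exp (- (?k u c * d\<^sup>2)))) =
          ennreal (l\<^sup>2 / 2) * ennreal (d\<^sup>2 * exp (- (?k u c * d\<^sup>2)))"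
        using True by (simp add: ennreal_mult[symmetric] power2_eq_square)
      with True show "ennreal (d / 2) * (?E d u (0 + d / 2 * c) * ?b (2 * (0 + d / 2 * c) / d)) = ?g d u c"
        unfolding e by (simp add: mult.assoc[symmetric])
    qed
    finally show ?thesis .
  next
    case False
    then have g: "?g d u c = 0" for c by (cases "d = 0") (auto split: split_indicator)
    show ?thesis unfolding g using False by (simp add: ennreal_neg)
  qed
  have d: "(\<integral>\<^sup>+d. ?g d u c \<partial>lborel) =
      ennreal (sqrt l / pi) * ennreal (slope_weight c) * ?b c * ennreal (slope_weight u)" for u c
  proof -
    have k: "0 < ?k u c" using l one_plus_square_pos[of u] one_plus_square_pos[of c] by simp
    let ?h = "\<lambda>d. ennreal (d\<^sup>2 * exp (- (?k u c * d\<^sup>2))) * indicator {0..} d"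
    have "(\<integral>\<^sup>+d. ?g d u c \<partial>lborel) = (\<integral>\<^sup>+d. ennreal (l\<^sup>2 / 2) * ?h d \<partial>lborel) * ?b c"
      by (rule nn_integral_multc) measurable
    also have "(\<integral>\<^sup>+d. ennreal (l\<^sup>2 / 2) * ?h d \<partial>lborel) = ennreal (l\<^sup>2 / 2) * (\<integral>\<^sup>+d. ?h d \<partial>lborel)"
      by (rule nn_integral_cmult) measurable
    also have "(\<integral>\<^sup>+d. ?h d \<partial>lborel) = ennreal (sqrt pi / (4 * (?k u c * sqrt (?k u c))))"
      by (rule nn_integral_gaussian_second_moment[OF k])
    also have "ennreal (l\<^sup>2 / 2) * ennreal (sqrt pi / (4 * (?k u c * sqrt (?k u c)))) =
        ennreal (l\<^sup>2 / 2 * (sqrt pi / (4 * (?k u c * sqrt (?k u c)))))"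
      using k by (intro ennreal_mult[symmetric]) auto
    also have "l\<^sup>2 / 2 * (sqrt pi / (4 * (?k u c * sqrt (?k u c)))) =
        sqrt l / pi * slope_weight c * slope_weight u"
    proof -
      \<comment> \<open>With \<open>l = s * s\<close> the roots of \<open>l\<close> disappear, and
        \<open>q\<close>, the root of \<open>pi\<close>, cancels, leaving an identity for field
        simplification.\<close>
      define s where "s = sqrt l"
      have s: "l = s * s" "0 < s" using l by (auto simp: s_def)
      define q where "q = sqrt pi"
      have q: "0 < q" by (simp add: q_def)
      have sk: "sqrt (?k u c) = s * q / 2 * (sqrt (1 + c\<^sup>2) * sqrt (1 + u\<^sup>2))"
        by (simp add: real_sqrt_mult real_sqrt_divide s_def q_def)
      show ?thesis
        unfolding sk s_def[symmetric] q_def[symmetric] slope_weight_def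
        using s q one_plus_square_pos[of u] one_plus_square_pos[of c]
        by (simp add: s(1) divide_simps power2_eq_square)
    qed
    also have "ennreal (sqrt l / pi * slope_weight c * slope_weight u) =
        ennreal (sqrt l / pi) * ennreal (slope_weight c) * ennreal (slope_weight u)"
      using l slope_weight_nonneg[of c] slope_weight_nonneg[of u]
      by (simp only: ennreal_mult mult_nonneg_nonneg divide_nonneg_pos pi_gt_zero real_sqrt_ge_zero less_imp_le)
    finally show ?thesis by (simp only: mult_ac)
  qed
  have "(\<integral>\<^sup>+p. ?f p \<partial>lborel) = (\<integral>\<^sup>+d. \<integral>\<^sup>+u. \<integral>\<^sup>+m. \<integral>\<^sup>+z. ennreal d *
      ?f ((z - d / 2 - u * m, m - u * d / 2), (z + d / 2 - u * m, m + u * d / 2)) \<partial>lborel \<partial>lborel \<partial>lborel \<partial>lborel)"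
    by (rule nn_integral_chord_coordinates) (measurable, simp add: crossing_pairs_def)
  also have "\<dots> = (\<integral>\<^sup>+d. \<integral>\<^sup>+u. \<integral>\<^sup>+c. ?g d u c \<partial>lborel \<partial>lborel \<partial>lborel)"
    by (simp only: z m)
  also have "\<dots> = (\<integral>\<^sup>+u. \<integral>\<^sup>+d. \<integral>\<^sup>+c. ?g d u c \<partial>lborel \<partial>lborel \<partial>lborel)"
    by (rule nn_integral_lborel_swap) measurable
  also have "\<dots> = (\<integral>\<^sup>+u. \<integral>\<^sup>+c. \<integral>\<^sup>+d. ?g d u c \<partial>lborel \<partial>lborel \<partial>lborel)"
    by (intro nn_integral_cong nn_integral_lborel_swap) measurable
  also have "\<dots> = (\<integral>\<^sup>+c. \<integral>\<^sup>+u. \<integral>\<^sup>+d. ?g d u c \<partial>lborel \<partial>lborel \<partial>lborel)"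
    by (rule nn_integral_lborel_swap) measurable
  also have "\<dots> = (\<integral>\<^sup>+c. ennreal (sqrt l / pi) * 2 * (ennreal (slope_weight c) * ?b c) \<partial>lborel)"
    unfolding d by (subst nn_integral_cmult) (simp_all add: nn_integral_slope_weight mult_ac)
  also have "\<dots> = ennreal (sqrt l / pi) * 2 * (\<integral>\<^sup>+t. ennreal (sin (t / 2) / 2) * indicator B t \<partial>lborel)"
    unfolding nn_integral_arctan_substitution[OF B, symmetric] by (rule nn_integral_cmult) measurable
  also have "\<dots> = ennreal (sqrt l / pi) * (\<integral>\<^sup>+t. 2 * (ennreal (sin (t / 2) / 2) * indicator B t) \<partial>lborel)"
    by (subst nn_integral_cmult) (simp_all add: mult_ac)
  also have "(\<integral>\<^sup>+t. 2 * (ennreal (sin (t / 2) / 2) * indicator B t) \<partial>lborel) =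
      (\<integral>\<^sup>+t. ennreal (sin (t / 2)) * indicator B t \<partial>lborel)"
  proof (intro nn_integral_cong)
    fix t
    have "2 * ennreal (sin (t / 2) / 2) = ennreal (sin (t / 2))" if "t \<in> B"
    proof -
      have "0 \<le> sin (t / 2)" using that B(2) by (intro sin_ge_zero) auto
      then show ?thesis
        using ennreal_mult[of 2 "sin (t / 2) / 2"] by simp
    qed
    then show "2 * (ennreal (sin (t / 2) / 2) * indicator B t) = ennreal (sin (t / 2)) * indicator B t"
      by (auto split: split_indicator)
  qed
  finally show ?thesis .
qed

subsection \<open>Voronoi facets crossing the axis\<close>

lemma mem_voronoi_cell: "x \<in> voronoi_cell S X \<longleftrightarrow> (\<forall>Y\<in>S. dist x X \<le> dist x Y)"
  by (auto simp: voronoi_cell_def le_INF_iff dist_norm)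

text \<open>The squares of \<open>z\<close> cancel, so equidistance is a linear equation in
  \<open>z\<close> with nonzero leading coefficient.\<close>

lemma dist_axis_eq_iff:
  assumes "fst X \<noteq> fst Y"
  shows "dist X (z, 0) = dist Y (z, 0) \<longleftrightarrow> z = bisector_crossing (X, Y)"
proof -
  obtain x1 x2 y1 y2 where XY: "X = (x1, x2)" "Y = (y1, y2)" by (cases X, cases Y)
  have "dist X (z, 0) = dist Y (z, 0) \<longleftrightarrow> (x1 - z)\<^sup>2 + x2\<^sup>2 = (y1 - z)\<^sup>2 + y2\<^sup>2"
    by (simp add: XY dist_prod_def dist_real_def)
  also have "\<dots> \<longleftrightarrow> 2 * (y1 - x1) * z = (y1 + x1) * (y1 - x1) + y2\<^sup>2 - x2\<^sup>2"
    by (simp add: power2_eq_square algebra_simps)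
  also have "\<dots> \<longleftrightarrow> z = bisector_crossing (X, Y)"
    using assms by (auto simp: XY bisector_crossing_def field_simps)
  finally show ?thesis .
qed

text \<open>Viewed as complex numbers, \<open>X - Z\<close> is \<open>Y - Z\<close> rotated by the
  angle \<open>t\<close>, where sine and cosine of \<open>t\<close> are the rational functions of
  \<open>c\<close> given by the double angle formulas. As \<open>t\<close> lies strictly between 0
  and \<open>2 * pi\<close>, it is the value of \<open>Arg2pi\<close>.\<close>

lemma clockwise_angle_eq_pair_angle:
  assumes less: "fst X < fst Y" and z: "z = bisector_crossing (X, Y)"
  shows "clockwise_angle X (z, 0) Y = pair_angle (X, Y)"
proof -
  obtain x1 x2 y1 y2 where XY: "X = (x1, x2)" "Y = (y1, y2)" by (cases X, cases Y)
  define d where "d = y1 - x1"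
  define c where "c = (x2 + y2) / d"
  define t where "t = pair_angle (X, Y)"
  have d: "0 < d" using less by (simp add: XY d_def)
  have sc: "sqrt (1 + c\<^sup>2) > 0" "sqrt (1 + c\<^sup>2) ^ 2 = 1 + c\<^sup>2" using one_plus_square_pos[of c] by simp_all
  have t_eq: "t = pi - 2 * arctan c" by (simp add: t_def pair_angle_def XY c_def d_def)
  have range: "0 < t" "t < 2 * pi"
    using arctan_bounded[of c] by (auto simp: t_eq)
  have cos_t: "cos t = (c\<^sup>2 - 1) / (1 + c\<^sup>2)"
    using sc by (simp add: t_eq cos_diff cos_double cos_arctan sin_arctan power_divide diff_divide_distrib)
  have sin_t: "sin t = 2 * c / (1 + c\<^sup>2)"
    using sc by (simp add: t_eq sin_diff sin_double cos_arctan sin_arctan power2_eq_square)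
  have zx: "x1 - z = - d / 2 - (y2\<^sup>2 - x2\<^sup>2) / (2 * d)" and zy: "y1 - z = d / 2 - (y2\<^sup>2 - x2\<^sup>2) / (2 * d)"
    by (simp_all add: z bisector_crossing_def XY d_def field_simps)
  \<comment> \<open>Expressing the heights through \<open>c\<close>, \<open>d\<close> and
    \<open>s\<close> turns both components of the rotation into rational identities.\<close>
  define s where "s = y2 - x2"
  have x2: "x2 = (c * d - s) / 2" and y2: "y2 = (c * d + s) / 2"
    using d by (simp_all add: c_def s_def)
  have q: "(y2\<^sup>2 - x2\<^sup>2) / (2 * d) = c * s / 2"
    using d by (simp add: x2 y2 power2_eq_square field_simps)
  have re: "x1 - z = cos t * (y1 - z) - sin t * y2"
    unfolding zx zy q unfolding cos_t sin_t y2 using one_plus_square_pos[of c]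
    by (simp add: divide_simps) (simp add: power2_eq_square algebra_simps)
  have im: "x2 = cos t * y2 + sin t * (y1 - z)"
    unfolding zy q unfolding cos_t sin_t x2 y2 using one_plus_square_pos[of c]
    by (simp add: divide_simps) (simp add: power2_eq_square algebra_simps)
  \<comment> \<open>If \<open>Y\<close> were at the centre, the rotation would put \<open>X\<close>
    there too, although their first coordinates differ by \<open>d\<close>.\<close>
  have nz: "Complex (y1 - z) y2 \<noteq> 0"
  proof
    assume "Complex (y1 - z) y2 = 0"
    then have "y1 - z = 0" "y2 = 0" by (simp_all add: complex_eq_iff)
    with re im show False using zx zy d by simp
  qed
  have "Complex (x1 - z) x2 = exp (\<i> * complex_of_real t) * Complex (y1 - z) y2"
    using re im by (simp add: complex_eq_iff exp_Euler Re_exp Im_exp cos_of_real sin_of_real)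
  then have "Complex (x1 - z) x2 / Complex (y1 - z) y2 = exp (\<i> * complex_of_real t)"
    using nz by (simp add: field_simps)
  then have "clockwise_angle X (z, 0) Y = Arg2pi (exp (\<i> * complex_of_real t))"
    by (simp add: clockwise_angle_def XY)
  also have "\<dots> = t"
    using range by (intro Arg2pi_unique[where r=1]) auto
  finally show ?thesis by (simp add: t_def)
qed

definition crossing_disc :: "point \<times> point \<Rightarrow> point set" where
  "crossing_disc p = ball (bisector_crossing p, 0) (crossing_radius p)"

text \<open>The properties of a single outcome on which the geometry rests. The last one excludes a
  third point on the boundary circle, which would make the choice of Delaunay neighbors ambiguous.
  It is confined to crossings in the unit interval, where the expected number of pairs is
  finite.\<close>

locale general_position =
  fixes S :: "point set"
  assumes finite: "\<And>B. bounded B \<Longrightarrow> finite (S \<inter> B)"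
    and distinct_fst: "\<And>X Y. X \<in> S \<Longrightarrow> Y \<in> S \<Longrightarrow> X \<noteq> Y \<Longrightarrow> fst X \<noteq> fst Y"
    and void_closed_disc: "\<And>X Y W. X \<in> S \<Longrightarrow> Y \<in> S \<Longrightarrow> fst X < fst Y \<Longrightarrow> bisector_crossing (X, Y) \<in> {0..1} \<Longrightarrow>
      S \<inter> crossing_disc (X, Y) = {} \<Longrightarrow> W \<in> S \<Longrightarrow>
      dist W (bisector_crossing (X, Y), 0) \<le> crossing_radius (X, Y) \<Longrightarrow> W = X \<or> W = Y"
begin

definition empty_disc_pairs :: "(point \<times> point) set" where
  "empty_disc_pairs = {(X, Y). X \<in> S \<and> Y \<in> S \<and> fst X < fst Y \<and> bisector_crossing (X, Y) \<in> {0..1} \<and>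
     S \<inter> crossing_disc (X, Y) = {}}"

text \<open>Membership in both cells makes \<open>X\<close> and \<open>Y\<close> equidistant from
  \<open>(z, 0)\<close>, which fixes \<open>z\<close>, and forbids points closer to it, which is
  emptiness of the open disc.\<close>

lemma nearest_pair_iff:
  assumes z: "z \<in> {0..1}"
  shows "X \<in> S \<and> Y \<in> S \<and> fst X < fst Y \<and> (z, 0) \<in> voronoi_cell S X \<inter> voronoi_cell S Y \<longleftrightarrow>
    (X, Y) \<in> empty_disc_pairs \<and> z = bisector_crossing (X, Y)"
proof
  assume *: "X \<in> S \<and> Y \<in> S \<and> fst X < fst Y \<and> (z, 0) \<in> voronoi_cell S X \<inter> voronoi_cell S Y"
  then have "dist X (z, 0) = dist Y (z, 0)"
    by (intro antisym) (auto simp: mem_voronoi_cell dist_commute)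
  with * have eq: "z = bisector_crossing (X, Y)" by (subst (asm) dist_axis_eq_iff) auto
  have "S \<inter> crossing_disc (X, Y) = {}"
    using * by (force simp: crossing_disc_def crossing_radius_def mem_voronoi_cell eq dist_commute not_less)
  with * eq z show "(X, Y) \<in> empty_disc_pairs \<and> z = bisector_crossing (X, Y)"
    by (auto simp: empty_disc_pairs_def)
next
  assume *: "(X, Y) \<in> empty_disc_pairs \<and> z = bisector_crossing (X, Y)"
  then have XY: "X \<in> S" "Y \<in> S" "fst X < fst Y" and void: "S \<inter> crossing_disc (X, Y) = {}"
    by (auto simp: empty_disc_pairs_def)
  have "dist X (z, 0) = dist Y (z, 0)" using * XY by (subst dist_axis_eq_iff) auto
  moreover have "dist (z, 0) X \<le> dist (z, 0) W" if "W \<in> S" for W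
    using that void * by (fastforce simp: crossing_disc_def crossing_radius_def dist_commute not_less)
  ultimately show "X \<in> S \<and> Y \<in> S \<and> fst X < fst Y \<and> (z, 0) \<in> voronoi_cell S X \<inter> voronoi_cell S Y"
    using XY by (auto simp: mem_voronoi_cell dist_commute)
qed

text \<open>By local finiteness only finitely many points lie within 1 of the disc, and each of them
  is strictly outside the closed disc, so a positive minimum is attained.\<close>

lemma gap:
  assumes "(X, Y) \<in> empty_disc_pairs"
  obtains e where "0 < e"
    "\<And>W. W \<in> S \<Longrightarrow> W \<noteq> X \<Longrightarrow> W \<noteq> Y \<Longrightarrow> crossing_radius (X, Y) + e \<le> dist W (bisector_crossing (X, Y), 0)"
proof -
  let ?c = "(bisector_crossing (X, Y), 0 :: real)" and ?r = "crossing_radius (X, Y)"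
  define F where "F = S \<inter> cball ?c (?r + 1) - {X, Y}"
  have "finite F" unfolding F_def using finite[OF bounded_cball] by simp
  \<comment> \<open>The value 1 serves the points beyond the enlarged ball and keeps the minimum
    defined when \<open>F\<close> is empty.\<close>
  define e where "e = Min (insert 1 ((\<lambda>W. dist W ?c - ?r) ` F))"
  have "?r < dist W ?c" if "W \<in> F" for W
    using assms that void_closed_disc[of X Y W] by (force simp: F_def empty_disc_pairs_def)
  then have "0 < e" unfolding e_def using \<open>finite F\<close> by (subst Min_gr_iff) auto
  moreover have "?r + e \<le> dist W ?c" if "W \<in> S" "W \<noteq> X" "W \<noteq> Y" for W
  proof (cases "W \<in> F")
    case True
    then have "e \<le> dist W ?c - ?r" unfolding e_def using \<open>finite F\<close> by (intro Min_le) auto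
    then show ?thesis by simp
  next
    case False
    then have "?r + 1 < dist W ?c" using that by (auto simp: F_def dist_commute not_le)
    moreover have "e \<le> 1" unfolding e_def using \<open>finite F\<close> by (intro Min_le) auto
    ultimately show ?thesis by simp
  qed
  ultimately show thesis by (rule that)
qed

text \<open>The gap leaves room to move from the crossing along the bisector while \<open>X\<close>
  and \<open>Y\<close> remain nearest. Two distinct common points force dimension at least 1; the
  bisector, a line, bounds it by 1.\<close>

lemma voronoi_facet_empty_disc:
  assumes "(X, Y) \<in> empty_disc_pairs"
  shows "voronoi_facet S X Y"
proof -
  let ?z = "bisector_crossing (X, Y)" and ?r = "crossing_radius (X, Y)"
  let ?c = "(?z, 0 :: real)"
  let ?V = "voronoi_cell S X \<inter> voronoi_cell S Y"
  have XY: "X \<in> S" "Y \<in> S" "fst X < fst Y" "?z \<in> {0..1}"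
    using assms by (auto simp: empty_disc_pairs_def)
  have c: "?c \<in> ?V" using nearest_pair_iff[OF XY(4), of X Y] assms by auto
  have rX: "dist ?c X = ?r" and rY: "dist ?c Y = ?r"
    using XY dist_axis_eq_iff[of X Y ?z] by (auto simp: crossing_radius_def dist_commute)
  obtain e where e: "0 < e"
    "\<And>W. W \<in> S \<Longrightarrow> W \<noteq> X \<Longrightarrow> W \<noteq> Y \<Longrightarrow> ?r + e \<le> dist W ?c"
    using gap[OF assms] by blast
  define n where "n = (- (snd Y - snd X), fst Y - fst X)"
  have n0: "n \<noteq> 0" using XY by (auto simp: n_def zero_prod_def)
  define t where "t = e / (2 * norm n)"
  have t: "0 < t" using n0 e by (simp add: t_def)
  define q where "q = ?c + t *\<^sub>R n"
  have qc: "dist q ?c = e / 2" using n0 e by (simp add: q_def dist_norm t_def)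
  have bis: "{x. dist x X = dist x Y} = {x. (Y - X) \<bullet> x = ((norm Y)\<^sup>2 - (norm X)\<^sup>2) / 2}"
  proof -
    have "dist x X = dist x Y \<longleftrightarrow> (norm (x - X))\<^sup>2 = (norm (x - Y))\<^sup>2" for x
      by (simp add: dist_norm)
    then show ?thesis
      by (auto simp: power2_norm_eq_inner inner_diff inner_commute field_simps)
  qed
  have orth: "(Y - X) \<bullet> n = 0"
    by (cases X, cases Y) (simp add: n_def inner_prod_def algebra_simps)
  have "?c \<in> {x. dist x X = dist x Y}" using rX rY by simp
  then have "q \<in> {x. dist x X = dist x Y}"
    unfolding bis using orth by (simp add: q_def inner_add_right)
  then have qXY: "dist q X = dist q Y" by simp
  \<comment> \<open>The shift by \<open>e / 2\<close> increases the distance to \<open>X\<close> and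
    decreases that to \<open>W\<close> by at most \<open>e / 2\<close> each, which the gap
    \<open>e\<close> just allows.\<close>
  have "dist q X \<le> dist q W" if "W \<in> S" for W
  proof (cases "W = X \<or> W = Y")
    case False
    then have "?r + e \<le> dist W ?c" using e that by blast
    moreover have "dist q X \<le> dist q ?c + dist ?c X" by (rule dist_triangle)
    moreover have "dist W ?c \<le> dist q W + dist q ?c" by (metis dist_commute dist_triangle)
    ultimately show ?thesis using qc rX by simp
  qed (use qXY in auto)
  then have q: "q \<in> ?V" using qXY by (auto simp: mem_voronoi_cell)
  have "aff_dim {?c, q} \<le> aff_dim ?V" using c q by (intro aff_dim_subset) auto
  moreover have "aff_dim {?c, q} = 1" using t n0 by (simp add: aff_dim_2 q_def)
  moreover have "aff_dim ?V \<le> 1"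
  proof -
    have "?V \<subseteq> {x. dist x X = dist x Y}"
      using XY by (auto simp: mem_voronoi_cell intro: antisym)
    then have "aff_dim ?V \<le> aff_dim {x. dist x X = dist x Y}" by (rule aff_dim_subset)
    moreover have "Y - X \<noteq> 0" using XY by auto
    then have "aff_dim {x. dist x X = dist x Y} = 1"
      unfolding bis by (subst aff_dim_hyperplane) simp_all
    ultimately show ?thesis by simp
  qed
  ultimately have "aff_dim ?V = 1" by simp
  then show ?thesis using XY by (auto simp: voronoi_facet_def)
qed

text \<open>The neighbors of any facet through the crossing are nearest points, hence lie in the
  closed disc, where only \<open>X\<close> and \<open>Y\<close> are available; the order of first
  coordinates decides which is which.\<close>

lemma delaunay_neighbors_eq:
  assumes p: "(X, Y) \<in> empty_disc_pairs"
  shows "delaunay_neighbors S (bisector_crossing (X, Y)) = (X, Y)"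
proof -
  let ?z = "bisector_crossing (X, Y)"
  have z: "?z \<in> {0..1}" using p by (auto simp: empty_disc_pairs_def)
  have uniq: "X' = X \<and> Y' = Y"
    if "voronoi_facet S X' Y'" "(?z, 0) \<in> voronoi_cell S X' \<inter> voronoi_cell S Y'" "fst X' < fst Y'" for X' Y'
  proof -
    have S: "X' \<in> S" "Y' \<in> S" "X \<in> S" "Y \<in> S" "fst X < fst Y"
      using that p by (auto simp: voronoi_facet_def empty_disc_pairs_def)
    have "dist W (?z, 0) \<le> crossing_radius (X, Y)" if "W = X' \<or> W = Y'" for W
      using that \<open>(?z, 0) \<in> voronoi_cell S X' \<inter> voronoi_cell S Y'\<close> S
      by (auto simp: mem_voronoi_cell crossing_radius_def dist_commute)
    then have "X' \<in> {X, Y}" "Y' \<in> {X, Y}"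
      using void_closed_disc[of X Y] p S by (auto simp: empty_disc_pairs_def)
    then show ?thesis using that(3) S by auto
  qed
  show ?thesis
    unfolding delaunay_neighbors_def
  proof (rule the_equality)
    show "case (X, Y) of (X, Y) \<Rightarrow> voronoi_facet S X Y \<and> (?z, 0) \<in> voronoi_cell S X \<inter> voronoi_cell S Y \<and> fst X < fst Y"
      using nearest_pair_iff[OF z, of X Y] p voronoi_facet_empty_disc[OF p] by simp
  qed (use uniq in auto)
qed

text \<open>The inverse is \<open>delaunay_neighbors S\<close>. Every crossing is reached because
  the two points of its facet have distinct first coordinates and can be put in order.\<close>

lemma bij_betw_bisector_crossing:
  "bij_betw bisector_crossing empty_disc_pairs (facet_crossings S \<inter> {0..1})"
proof (rule bij_betw_byWitness[where f'="delaunay_neighbors S"])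
  show "\<forall>p\<in>empty_disc_pairs. delaunay_neighbors S (bisector_crossing p) = p"
    using delaunay_neighbors_eq by auto
  show "bisector_crossing ` empty_disc_pairs \<subseteq> facet_crossings S \<inter> {0..1}"
  proof (clarify)
    fix X Y assume p: "(X, Y) \<in> empty_disc_pairs"
    then have z: "bisector_crossing (X, Y) \<in> {0..1}" by (auto simp: empty_disc_pairs_def)
    then show "bisector_crossing (X, Y) \<in> facet_crossings S \<inter> {0..1}"
      unfolding facet_crossings_def
      using nearest_pair_iff[OF z, of X Y] p voronoi_facet_empty_disc[OF p] by blast
  qed
  have *: "\<exists>p\<in>empty_disc_pairs. z = bisector_crossing p" if z: "z \<in> facet_crossings S" "z \<in> {0..1}" for z
  proof -
    obtain X Y where XY: "voronoi_facet S X Y" "(z, 0) \<in> voronoi_cell S X \<inter> voronoi_cell S Y"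
      using z by (auto simp: facet_crossings_def)
    then have "X \<in> S" "Y \<in> S" "fst X < fst Y \<or> fst Y < fst X"
      using distinct_fst[of X Y] by (auto simp: voronoi_facet_def)
    then show ?thesis
      using nearest_pair_iff[OF z(2), of X Y] nearest_pair_iff[OF z(2), of Y X] XY(2) by blast
  qed
  then show "\<forall>z\<in>facet_crossings S \<inter> {0..1}. bisector_crossing (delaunay_neighbors S z) = z"
    using delaunay_neighbors_eq by fastforce
  show "delaunay_neighbors S ` (facet_crossings S \<inter> {0..1}) \<subseteq> empty_disc_pairs"
    using * delaunay_neighbors_eq by fastforce
qed

lemma crossing_angle_eq_pair_angle:
  assumes "p \<in> empty_disc_pairs"
  shows "crossing_angle S (bisector_crossing p) = pair_angle p"
  using assms delaunay_neighbors_eq clockwise_angle_eq_pair_angle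
  by (cases p) (auto simp: crossing_angle_def empty_disc_pairs_def)

lemma nn_integral_crossing_angle:
  "(\<integral>\<^sup>+z. indicator B (crossing_angle S z) \<partial>count_space (facet_crossings S \<inter> {0..1})) =
    num {p \<in> empty_disc_pairs. pair_angle p \<in> B}"
proof -
  have "(\<integral>\<^sup>+z. indicator B (crossing_angle S z) \<partial>count_space (facet_crossings S \<inter> {0..1})) =
      (\<integral>\<^sup>+p. indicator B (crossing_angle S (bisector_crossing p)) \<partial>count_space empty_disc_pairs)"
    by (rule nn_integral_bij_count_space[OF bij_betw_bisector_crossing, symmetric])
  also have "\<dots> = (\<integral>\<^sup>+p. indicator {p \<in> empty_disc_pairs. pair_angle p \<in> B} p \<partial>count_space empty_disc_pairs)"
    by (intro nn_integral_cong) (simp add: crossing_angle_eq_pair_angle indicator_def)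
  also have "\<dots> = emeasure (count_space empty_disc_pairs) {p \<in> empty_disc_pairs. pair_angle p \<in> B}"
    by (intro nn_integral_indicator) auto
  also have "\<dots> = num {p \<in> empty_disc_pairs. pair_angle p \<in> B}"
    by (cases "finite {p \<in> empty_disc_pairs. pair_angle p \<in> B}")
      (auto simp: emeasure_count_space_finite emeasure_count_space_infinite)
  finally show ?thesis .
qed

end

subsection \<open>Almost sure general position\<close>

lemma emeasure_equal_fst: "emeasure lborel {p :: point \<times> point. fst (fst p) = fst (snd p)} = 0"
proof -
  let ?A = "{p :: point \<times> point. fst (fst p) = fst (snd p)}"
  have [measurable]: "?A \<in> sets borel" by measurable
  have zero: "(\<integral>\<^sup>+y1. \<integral>\<^sup>+y2. indicator ?A ((x1, x2), (y1, y2)) \<partial>lborel \<partial>lborel) = (0 :: ennreal)" for x1 x2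
  proof -
    have "AE y1 in lborel. y1 \<noteq> x1" by (rule AE_lborel_singleton)
    then have "(\<integral>\<^sup>+y1. \<integral>\<^sup>+y2. indicator ?A ((x1, x2), (y1, y2)) \<partial>lborel \<partial>lborel) =
        (\<integral>\<^sup>+y1. (0 :: ennreal) \<partial>(lborel :: real measure))"
      by (intro nn_integral_cong_AE) (auto elim: eventually_mono)
    then show ?thesis by simp
  qed
  have "emeasure lborel ?A = (\<integral>\<^sup>+p. indicator ?A p \<partial>lborel)" by simp
  also have "\<dots> = (\<integral>\<^sup>+x1. \<integral>\<^sup>+x2. \<integral>\<^sup>+y1. \<integral>\<^sup>+y2. indicator ?A ((x1, x2), (y1, y2)) \<partial>lborel \<partial>lborel \<partial>lborel \<partial>lborel)"
    by (rule nn_integral_pairs_of_points) measurable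
  finally show ?thesis unfolding zero by simp
qed

lemma measure_ball_plane:
  fixes c :: point
  assumes "0 \<le> r"
  shows "measure lborel (ball c r) = pi * r\<^sup>2"
  using assms by (simp add: content_ball unit_ball_vol_2 power2_eq_square)

lemma pair_angle_range: "pair_angle p \<in> {0<..<2 * pi}"
  using arctan_bounded[of "(snd (fst p) + snd (snd p)) / (fst (snd p) - fst (fst p))"]
  by (auto simp: pair_angle_def)

locale planar_poisson_process = homogeneous_poisson_process M \<Phi> intensity
  for M :: "'w measure" and \<Phi> :: "'w \<Rightarrow> point set" and intensity +
  assumes intensity_pos: "0 < intensity"
begin

text \<open>For positive \<open>e\<close> the ball contains the pair itself, so without the removal
  no pair of the process could have a void region.\<close>

definition enlarged_disc :: "real \<Rightarrow> point \<times> point \<Rightarrow> point set" where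
  "enlarged_disc e p = ball (bisector_crossing p, 0) (crossing_radius p + e) - {fst p, snd p}"

lemma
  assumes B: "B \<in> sets borel" and e: "0 \<le> e"
  shows measurable_void_crossing_pairs [measurable]:
      "(\<lambda>\<omega>. num (void_pairs (crossing_pairs B) (enlarged_disc e) \<omega>)) \<in> borel_measurable M"
    and nn_integral_void_crossing_pairs:
      "(\<integral>\<^sup>+\<omega>. num (void_pairs (crossing_pairs B) (enlarged_disc e) \<omega>) \<partial>M) =
        (\<integral>\<^sup>+p. ennreal (intensity\<^sup>2 * exp (- (intensity * (pi * (crossing_radius p + e)\<^sup>2)))) *
          indicator (crossing_pairs B) p \<partial>lborel)"
proof -
  have c: "(\<lambda>p. (bisector_crossing p, 0 :: real)) \<in> borel_measurable borel"
    by (intro borel_measurable_Pair) measurable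
  have r: "(\<lambda>p. crossing_radius p + e) \<in> borel_measurable borel" by measurable
  note * = void_pairs_ball[OF sets_crossing_pairs[OF B] less_imp_le[OF intensity_pos] c r,
      folded enlarged_disc_def]
  show "(\<lambda>\<omega>. num (void_pairs (crossing_pairs B) (enlarged_disc e) \<omega>)) \<in> borel_measurable M"
    using *(1) by (simp add: enlarged_disc_def[abs_def])
  have "measure lborel (ball (bisector_crossing p, 0 :: real) (crossing_radius p + e)) =
      pi * (crossing_radius p + e)\<^sup>2" for p
    using e by (intro measure_ball_plane) (simp add: crossing_radius_def)
  then show "(\<integral>\<^sup>+\<omega>. num (void_pairs (crossing_pairs B) (enlarged_disc e) \<omega>) \<partial>M) =
        (\<integral>\<^sup>+p. ennreal (intensity\<^sup>2 * exp (- (intensity * (pi * (crossing_radius p + e)\<^sup>2)))) *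
          indicator (crossing_pairs B) p \<partial>lborel)"
    using *(2) by (simp add: enlarged_disc_def[abs_def])
qed

lemma nn_integral_empty_disc_pairs:
  assumes B: "B \<in> sets borel" "B \<subseteq> {0<..<2 * pi}"
  shows "(\<integral>\<^sup>+\<omega>. num (void_pairs (crossing_pairs B) (enlarged_disc 0) \<omega>) \<partial>M) =
    ennreal (sqrt intensity / pi) * (\<integral>\<^sup>+t. ennreal (sin (t / 2)) * indicator B t \<partial>lborel)"
  using nn_integral_void_crossing_pairs[OF B(1), of 0] nn_integral_crossing_pairs[OF intensity_pos B] by simp

text \<open>A ball of radius 0 is empty, so the void formula counts all pairs in a Borel set. Pairs
  with equal first coordinates form a null set, hence their expected number is 0.\<close>

lemma AE_distinct_fst: "AE \<omega> in M. \<forall>X\<in>\<Phi> \<omega>. \<forall>Y\<in>\<Phi> \<omega>. X \<noteq> Y \<longrightarrow> fst X \<noteq> fst Y"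
proof -
  let ?A = "{p :: point \<times> point. fst (fst p) = fst (snd p)}"
  let ?D = "\<lambda>p. ball (0::point) 0 - {fst p, snd p}"
  have A: "?A \<in> sets borel" by measurable
  have meas: "(\<lambda>\<omega>. num (void_pairs ?A ?D \<omega>)) \<in> borel_measurable M"
    using intensity_pos by (intro void_pairs_ball A) auto
  have "(\<integral>\<^sup>+\<omega>. num (void_pairs ?A ?D \<omega>) \<partial>M) =
      (\<integral>\<^sup>+p. ennreal (intensity\<^sup>2 * exp (- (intensity * measure lborel (ball (0::point) 0)))) * indicator ?A p \<partial>lborel)"
    using intensity_pos by (intro void_pairs_ball A) auto
  also have "\<dots> = 0" using A emeasure_equal_fst by (simp add: nn_integral_cmult_indicator)
  finally have "AE \<omega> in M. num (void_pairs ?A ?D \<omega>) = 0"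
    using meas by (simp add: nn_integral_0_iff_AE)
  then show ?thesis
  proof eventually_elim
    case (elim \<omega>)
    then have "void_pairs ?A ?D \<omega> = {}" by (auto simp: emeasure_count_space_eq_0)
    show ?case
    proof (intro ballI impI notI)
      fix X Y assume "X \<in> \<Phi> \<omega>" "Y \<in> \<Phi> \<omega>" "X \<noteq> Y" "fst X = fst Y"
      then have "(X, Y) \<in> void_pairs ?A ?D \<omega>" by (simp add: void_pairs_def ordered_pairs_def)
      with \<open>void_pairs ?A ?D \<omega> = {}\<close> show False by blast
    qed
  qed
qed

text \<open>
  Enlarging the disc by \<open>e\<close> changes the expected number of pairs by an amount that vanishes as
  \<open>e \<rightarrow> 0\<close>; hence almost surely no further point lies on the boundary circle of an empty disc.
\<close>
lemma AE_void_pairs_enlarged_disc: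
  "AE \<omega> in M. \<forall>p\<in>void_pairs (crossing_pairs {0<..<2 * pi}) (enlarged_disc 0) \<omega>.
    \<exists>n. \<Phi> \<omega> \<inter> enlarged_disc (1 / real (Suc n)) p = {}"
proof -
  let ?A = "crossing_pairs {0<..<2 * pi}"
  let ?V = "\<lambda>n \<omega>. void_pairs ?A (enlarged_disc (1 / real (Suc n))) \<omega>"
  let ?E = "\<lambda>\<omega>. void_pairs ?A (enlarged_disc 0) \<omega>"
  let ?w = "\<lambda>e p. ennreal (intensity\<^sup>2 * exp (- (intensity * (pi * (crossing_radius p + e)\<^sup>2)))) * indicator ?A p"
  have B: "{0<..<2 * pi} \<in> sets borel" by simp
  note [measurable] = sets_crossing_pairs[OF B]
  have mono_disc: "enlarged_disc e p \<subseteq> enlarged_disc e' p" if "e \<le> e'" for e e' p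
    using that by (auto simp: enlarged_disc_def)
  have inc: "incseq (\<lambda>n. ?V n \<omega>)" for \<omega>
  proof (rule incseq_SucI)
    fix n
    have "enlarged_disc (1 / real (Suc (Suc n))) p \<subseteq> enlarged_disc (1 / real (Suc n)) p" for p
      by (rule mono_disc) (simp add: field_simps)
    then show "?V n \<omega> \<subseteq> ?V (Suc n) \<omega>" by (fastforce simp: void_pairs_def)
  qed
  have sub: "?V n \<omega> \<subseteq> ?E \<omega>" for n \<omega>
    using mono_disc[of 0 "1 / real (Suc n)"] by (fastforce simp: void_pairs_def)
  have meas: "(\<lambda>\<omega>. num (?V n \<omega>)) \<in> borel_measurable M" "(\<lambda>\<omega>. num (?E \<omega>)) \<in> borel_measurable M" for n
    by (intro measurable_void_crossing_pairs B; simp)+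
  have SUP: "num (\<Union>n. ?V n \<omega>) = (SUP n. num (?V n \<omega>))" for \<omega>
    using inc by (intro SUP_emeasure_incseq[symmetric]) auto
  have measU: "(\<lambda>\<omega>. num (\<Union>n. ?V n \<omega>)) \<in> borel_measurable M"
    unfolding SUP using meas by (intro borel_measurable_SUP) auto
  have incw: "incseq (\<lambda>n p. ?w (1 / real (Suc n)) p)"
  proof (intro incseq_SucI le_funI mult_right_mono ennreal_leI mult_left_mono)
    fix n p
    have "1 / real (Suc (Suc n)) \<le> 1 / real (Suc n)" by (simp add: field_simps)
    then have "(crossing_radius p + 1 / real (Suc (Suc n)))\<^sup>2 \<le> (crossing_radius p + 1 / real (Suc n))\<^sup>2"
      by (intro power_mono) (simp_all add: crossing_radius_def)
    then show "exp (- (intensity * (pi * (crossing_radius p + 1 / real (Suc n))\<^sup>2)))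
        \<le> exp (- (intensity * (pi * (crossing_radius p + 1 / real (Suc (Suc n)))\<^sup>2)))"
      unfolding exp_le_cancel_iff neg_le_iff_le using intensity_pos by (intro mult_left_mono) auto
  qed simp_all
  have supw: "(SUP n. ?w (1 / real (Suc n)) p) = ?w 0 p" for p
  proof (rule LIMSEQ_unique[OF LIMSEQ_SUP])
    show "incseq (\<lambda>n. ?w (1 / real (Suc n)) p)"
      by (rule incseq_SucI) (rule le_funD[OF incseq_SucD[OF incw]])
    have lim: "(\<lambda>n. crossing_radius p + 1 / real (Suc n)) \<longlonglongrightarrow> crossing_radius p + 0"
      by (intro tendsto_add tendsto_const) real_asymp
    have "(\<lambda>n. ennreal (intensity\<^sup>2 * exp (- (intensity * (pi * (crossing_radius p + 1 / real (Suc n))\<^sup>2)))))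
        \<longlonglongrightarrow> ennreal (intensity\<^sup>2 * exp (- (intensity * (pi * (crossing_radius p + 0)\<^sup>2))))"
      by (intro tendsto_ennrealI tendsto_mult[OF tendsto_const] tendsto_exp tendsto_minus tendsto_power lim)
    then show "(\<lambda>n. ?w (1 / real (Suc n)) p) \<longlonglongrightarrow> ?w 0 p"
      by (cases "p \<in> ?A") simp_all
  qed
  have "(\<integral>\<^sup>+\<omega>. num (\<Union>n. ?V n \<omega>) \<partial>M) = (SUP n. \<integral>\<^sup>+\<omega>. num (?V n \<omega>) \<partial>M)"
    unfolding SUP using meas
    by (intro nn_integral_monotone_convergence_SUP incseq_SucI le_funI emeasure_mono incseq_SucD[OF inc]) auto
  also have "\<dots> = (SUP n. \<integral>\<^sup>+p. ?w (1 / real (Suc n)) p \<partial>lborel)"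
    by (subst nn_integral_void_crossing_pairs[OF B]) simp_all
  also have "\<dots> = (\<integral>\<^sup>+p. (SUP n. ?w (1 / real (Suc n)) p) \<partial>lborel)"
    by (intro nn_integral_monotone_convergence_SUP[symmetric] incw) measurable
  also have "\<dots> = (\<integral>\<^sup>+\<omega>. num (?E \<omega>) \<partial>M)"
    unfolding supw by (rule nn_integral_void_crossing_pairs[OF B, symmetric]) simp
  finally have eq: "(\<integral>\<^sup>+\<omega>. num (\<Union>n. ?V n \<omega>) \<partial>M) = (\<integral>\<^sup>+\<omega>. num (?E \<omega>) \<partial>M)" .
  have fin: "(\<integral>\<^sup>+\<omega>. num (?E \<omega>) \<partial>M) \<noteq> \<infinity>"
  proof -
    have "(\<integral>\<^sup>+t. ennreal (sin (t / 2)) * indicator {0<..<2 * pi} t \<partial>lborel) \<le>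
        (\<integral>\<^sup>+t. indicator {0<..<2 * pi} t \<partial>lborel)"
      by (intro nn_integral_mono) (auto split: split_indicator simp: ennreal_le_1)
    also have "\<dots> < \<infinity>" by simp
    finally show ?thesis
      unfolding nn_integral_empty_disc_pairs[OF B order_refl] by (simp add: ennreal_mult_eq_top_iff)
  qed
  have le: "num (\<Union>n. ?V n \<omega>) \<le> num (?E \<omega>)" for \<omega>
    by (intro emeasure_mono UN_least sub) simp
  \<comment> \<open>The counts are ordered and share a finite expectation, so their difference has
    integral 0 and vanishes almost surely.\<close>
  have "(\<integral>\<^sup>+\<omega>. num (?E \<omega>) - num (\<Union>n. ?V n \<omega>) \<partial>M) =
      (\<integral>\<^sup>+\<omega>. num (?E \<omega>) \<partial>M) - (\<integral>\<^sup>+\<omega>. num (\<Union>n. ?V n \<omega>) \<partial>M)"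
    by (intro nn_integral_diff AE_I2 le meas measU) (simp only: eq fin not_False_eq_True)
  also have "\<dots> = 0" unfolding eq using fin by simp
  finally have "(\<integral>\<^sup>+\<omega>. num (?E \<omega>) - num (\<Union>n. ?V n \<omega>) \<partial>M) = 0" .
  then have "AE \<omega> in M. num (?E \<omega>) - num (\<Union>n. ?V n \<omega>) = 0"
    using meas measU by (subst (asm) nn_integral_0_iff_AE) auto
  moreover have "AE \<omega> in M. num (?E \<omega>) \<noteq> \<infinity>"
    using meas(2) fin by (rule nn_integral_PInf_AE)
  ultimately show ?thesis
  proof eventually_elim
    case (elim \<omega>)
    have "(\<Union>n. ?V n \<omega>) \<subseteq> ?E \<omega>" using sub by blast
    then have "num (?E \<omega> - (\<Union>n. ?V n \<omega>)) = 0"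
      using elim le[of \<omega>] by (subst emeasure_Diff) (auto simp: top_unique)
    then have "?E \<omega> \<subseteq> (\<Union>n. ?V n \<omega>)" by (auto simp: emeasure_count_space_eq_0)
    then show ?case unfolding void_pairs_def by blast
  qed
qed

text \<open>Both points lie on the boundary circle, outside the open ball, so removing them changes
  nothing.\<close>

lemma void_pairs_enlarged_disc_0:
  "void_pairs (crossing_pairs B) (enlarged_disc 0) \<omega> =
    {(X, Y). X \<in> \<Phi> \<omega> \<and> Y \<in> \<Phi> \<omega> \<and> fst X < fst Y \<and> bisector_crossing (X, Y) \<in> {0..1} \<and>
      \<Phi> \<omega> \<inter> crossing_disc (X, Y) = {} \<and> pair_angle (X, Y) \<in> B}"
proof -
  have "enlarged_disc 0 (X, Y) = crossing_disc (X, Y)" if "fst X < fst Y" for X Y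
    using that dist_axis_eq_iff[of X Y "bisector_crossing (X, Y)"]
    by (auto simp: enlarged_disc_def crossing_disc_def crossing_radius_def dist_commute)
  then show ?thesis
    by (auto simp: void_pairs_def ordered_pairs_def crossing_pairs_def)
qed

text \<open>A third point in the closed disc would belong to every enlarged disc, whereas one of
  these is void. Restricting angles to \<open>(0, 2 pi)\<close> loses no pair, since every
  \<open>pair_angle\<close> lies there.\<close>

lemma AE_general_position: "AE \<omega> in M. general_position (\<Phi> \<omega>)"
  using AE_distinct_fst AE_void_pairs_enlarged_disc AE_space
proof eventually_elim
  case (elim \<omega>)
  show ?case
  proof
    show "finite (\<Phi> \<omega> \<inter> B)" if "bounded B" for B
      using locally_finite elim(3) that by blast
    show "fst X \<noteq> fst Y" if "X \<in> \<Phi> \<omega>" "Y \<in> \<Phi> \<omega>" "X \<noteq> Y" for X Y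
      using elim(1) that by blast
    fix X Y W
    assume X: "X \<in> \<Phi> \<omega>" "Y \<in> \<Phi> \<omega>" "fst X < fst Y" "bisector_crossing (X, Y) \<in> {0..1}"
        "\<Phi> \<omega> \<inter> crossing_disc (X, Y) = {}"
      and W: "W \<in> \<Phi> \<omega>" "dist W (bisector_crossing (X, Y), 0) \<le> crossing_radius (X, Y)"
    then have "(X, Y) \<in> void_pairs (crossing_pairs {0<..<2 * pi}) (enlarged_disc 0) \<omega>"
      using pair_angle_range[of "(X, Y)"] unfolding void_pairs_enlarged_disc_0 by blast
    then obtain n where n: "\<Phi> \<omega> \<inter> enlarged_disc (1 / real (Suc n)) (X, Y) = {}"
      using elim(2) by blast
    have "crossing_radius (X, Y) < crossing_radius (X, Y) + 1 / real (Suc n)" by simp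
    then have "dist (bisector_crossing (X, Y), 0) W < crossing_radius (X, Y) + 1 / real (Suc n)"
      using W(2) by (simp only: dist_commute)
    then show "W = X \<or> W = Y"
      using n W(1) by (auto simp: enlarged_disc_def)
  qed
qed

lemma nn_integral_crossing_angles:
  assumes B: "B \<in> sets borel" "B \<subseteq> {0<..<2 * pi}"
  shows "(\<integral>\<^sup>+\<omega>. (\<integral>\<^sup>+z. indicator B (crossing_angle (\<Phi> \<omega>) z)
        \<partial>count_space (facet_crossings (\<Phi> \<omega>) \<inter> {0..1})) \<partial>M) =
    ennreal (sqrt intensity / pi) * (\<integral>\<^sup>+t. ennreal (sin (t / 2)) * indicator B t \<partial>lborel)"
proof -
  have "AE \<omega> in M. (\<integral>\<^sup>+z. indicator B (crossing_angle (\<Phi> \<omega>) z)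
        \<partial>count_space (facet_crossings (\<Phi> \<omega>) \<inter> {0..1})) =
      num (void_pairs (crossing_pairs B) (enlarged_disc 0) \<omega>)"
    using AE_general_position
  proof eventually_elim
    case (elim \<omega>)
    then interpret general_position "\<Phi> \<omega>" .
    have "{p \<in> empty_disc_pairs. pair_angle p \<in> B} = void_pairs (crossing_pairs B) (enlarged_disc 0) \<omega>"
      unfolding void_pairs_enlarged_disc_0 by (auto simp: empty_disc_pairs_def)
    then show ?case by (simp only: nn_integral_crossing_angle)
  qed
  then show ?thesis
    unfolding nn_integral_empty_disc_pairs[OF B, symmetric] by (rule nn_integral_cong_AE)
qed

end

theorem lemma2:
  fixes M :: "'w measure" and \<Phi> :: "'w \<Rightarrow> (real \<times> real) set" and intensity :: real
  assumes "intensity > 0"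
    and "homogeneous_poisson_process M \<Phi> intensity"
  shows "palm_mark_distribution M (4 * sqrt intensity / pi)
           (\<lambda>\<omega>. facet_crossings (\<Phi> \<omega>)) (\<lambda>\<omega>. crossing_angle (\<Phi> \<omega>))
           (restrict_space borel {0<..<2 * pi}) =
         density (restrict_space lborel {0<..<2 * pi}) (\<lambda>t. ennreal (1 / 4 * sin (t / 2)))"
proof -
  interpret homogeneous_poisson_process M \<Phi> intensity by (rule assms)
  interpret planar_poisson_process M \<Phi> intensity by unfold_locales (rule assms)
  let ?T = "{0<..<2 * pi}"
  let ?R = "density (restrict_space lborel ?T) (\<lambda>t. ennreal (1 / 4 * sin (t / 2)))"
  have "ennreal (1 / (4 * sqrt intensity / pi)) * (\<integral>\<^sup>+\<omega>. (\<integral>\<^sup>+z. indicator B (crossing_angle (\<Phi> \<omega>) z)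
        \<partial>count_space (facet_crossings (\<Phi> \<omega>) \<inter> {0..1})) \<partial>M) = emeasure ?R B"
    if "B \<in> sets (restrict_space borel ?T)" for B
  proof -
    have B: "B \<in> sets borel" "B \<subseteq> ?T"
      using that by (auto simp: sets_restrict_space_iff)
    note [measurable] = B(1)
    \<comment> \<open>Dividing by the linear intensity cancels \<open>sqrt intensity / pi\<close>;
      the density does not depend on the intensity.\<close>
    have "ennreal (1 / (4 * sqrt intensity / pi)) * ennreal (sqrt intensity / pi) = ennreal (1 / 4)"
      using assms(1) by (subst ennreal_mult[symmetric]) auto
    then have "ennreal (1 / (4 * sqrt intensity / pi)) * (\<integral>\<^sup>+\<omega>. (\<integral>\<^sup>+z. indicator B (crossing_angle (\<Phi> \<omega>) z)
          \<partial>count_space (facet_crossings (\<Phi> \<omega>) \<inter> {0..1})) \<partial>M) =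
        ennreal (1 / 4) * (\<integral>\<^sup>+t. ennreal (sin (t / 2)) * indicator B t \<partial>lborel)"
      unfolding nn_integral_crossing_angles[OF B] by (simp only: mult.assoc[symmetric])
    also have "\<dots> = (\<integral>\<^sup>+t. ennreal (1 / 4) * (ennreal (sin (t / 2)) * indicator B t) \<partial>lborel)"
      by (rule nn_integral_cmult[symmetric]) measurable
    also have "\<dots> = (\<integral>\<^sup>+t. ennreal (1 / 4 * sin (t / 2)) * indicator B t * indicator ?T t \<partial>lborel)"
    proof (intro nn_integral_cong)
      fix t
      have "ennreal (1 / 4 * sin (t / 2)) = ennreal (1 / 4) * ennreal (sin (t / 2))"
        by (rule ennreal_mult') simp
      with B(2) show "ennreal (1 / 4) * (ennreal (sin (t / 2)) * indicator B t) =
          ennreal (1 / 4 * sin (t / 2)) * indicator B t * indicator ?T t"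
        by (auto simp only: mult.assoc mult_1_left mult_1_right mult_zero_left mult_zero_right
            split: split_indicator)
    qed
    also have "\<dots> = (\<integral>\<^sup>+t. ennreal (1 / 4 * sin (t / 2)) * indicator B t \<partial>restrict_space lborel ?T)"
      by (rule nn_integral_restrict_space[symmetric]) simp
    also have "\<dots> = emeasure ?R B"
    proof (rule emeasure_density[symmetric])
      show "B \<in> sets (restrict_space lborel ?T)"
        using B by (auto simp: sets_restrict_space_iff)
    qed (intro measurable_restrict_space1, measurable)
    finally show ?thesis .
  qed
  \<comment> \<open>The set function in the Palm distribution now agrees with a measure on the whole
    sigma-algebra, so \<open>measure_of\<close> returns that measure without a separate proof of
    countable additivity.\<close>
  moreover have "space (restrict_space borel ?T) = space ?R" "sets (restrict_space borel ?T) = sets ?R"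
    by (simp_all add: space_restrict_space sets_restrict_space)
  ultimately have "palm_mark_distribution M (4 * sqrt intensity / pi)
      (\<lambda>\<omega>. facet_crossings (\<Phi> \<omega>)) (\<lambda>\<omega>. crossing_angle (\<Phi> \<omega>)) (restrict_space borel ?T) =
    measure_of (space ?R) (sets ?R) (emeasure ?R)"
    unfolding palm_mark_distribution_def
    by (simp only:) (intro measure_of_eq sets.space_closed, simp only: sets.sigma_sets_eq)
  then show ?thesis by (simp only: measure_of_of_measure)
qed

end
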